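(* Let $A$ be a separable AF-algebra. Then $\operatorname{gr}(A)\le 1$, and a generic element of $A$ is a generator, that is, $\{a\in A: C^*(a)=A\}$ is a dense $G_\delta$-subset of $A$. In particular, $A$ is singly generated, that is, there exists $a\in A$ with $C^*(a)=A$.
   Context: An AF-algebra is a $C^*$-algebra isomorphic to an inductive limit of finite-dimensional $C^*$-algebras. Notation: for a $C^*$-algebra $A$, $A_{\mathrm{sa}}$ is the set of self-adjoint elements; $C^*(b_0,\dots,b_n)$ is the (not necessarily unital) sub-$C^*$-algebra generated by $b_0,\dots,b_n$; $\widetilde{A}$ is the minimal unitization ($\widetilde A=A$ if $A$ is unital). For $G\subseteq A$, $c\in_\varepsilon G$ means that there is $g\in G$ with $\|c-g\|<\varepsilon$. $\operatorname{gr}_0(A)$ is the smallest integer $n\ge 0$ such that for all $a_0,\dots,a_n\in A_{\mathrm{sa}}$, $\varepsilon>0$ and $c\in A$ there exist $b_0,\dots,b_n\in A_{\mathrm{sa}}$ with $\|b_j-a_j\|<\varepsilon$ for $j=0,\dots,n$ and $c\in_\varepsilon C^*(b_0,\dots,b_n)$; $\operatorname{gr}_0(A)=\infty$ if no such $n$ exists. The generator rank of $A$ is $\operatorname{gr}(A):=\operatorname{gr}_0(\widetilde A)$. *)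

theory Defs
  imports "HOL-Analysis.Analysis" "HOL-Library.Extended_Nat"
begin

section \<open>C*-algebras, not necessarily unital\<close>

class cstar_algebra = real_normed_algebra + banach +
  fixes scaleC :: "complex \<Rightarrow> 'a \<Rightarrow> 'a" (infixr "*\<^sub>C" 75)
    and star :: "'a \<Rightarrow> 'a"
  assumes scaleR_scaleC: "scaleR r x = complex_of_real r *\<^sub>C x"
    and scaleC_add_right: "c *\<^sub>C (x + y) = c *\<^sub>C x + c *\<^sub>C y"
    and scaleC_add_left: "(c + d) *\<^sub>C x = c *\<^sub>C x + d *\<^sub>C x"
    and scaleC_scaleC: "c *\<^sub>C d *\<^sub>C x = (c * d) *\<^sub>C x"
    and mult_scaleC_left: "(c *\<^sub>C x) * y = c *\<^sub>C (x * y)"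
    and mult_scaleC_right: "x * (c *\<^sub>C y) = c *\<^sub>C (x * y)"
    and norm_scaleC: "norm (c *\<^sub>C x) = cmod c * norm x"
    and star_star: "star (star x) = x"
    and star_add: "star (x + y) = star x + star y"
    and star_scaleC: "star (c *\<^sub>C x) = cnj c *\<^sub>C star x"
    and star_mult: "star (x * y) = star y * star x"
    and cstar_identity: "norm (star x * x) = (norm x)\<^sup>2"

lemma scaleC_one: "1 *\<^sub>C (x :: 'a :: cstar_algebra) = x"
  using scaleR_scaleC[of 1 x] by simp

global_interpretation complex_vector:
  vector_space "scaleC :: complex \<Rightarrow> 'a \<Rightarrow> 'a :: cstar_algebra"
  by standard (simp_all add: scaleC_add_right scaleC_add_left scaleC_scaleC scaleC_one)

definition self_adjoint :: "'a :: cstar_algebra \<Rightarrow> bool" where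
  "self_adjoint a \<longleftrightarrow> star a = a"

definition cstar_subalgebra :: "'a :: cstar_algebra set \<Rightarrow> bool" where
  "cstar_subalgebra B \<longleftrightarrow> complex_vector.subspace B \<and>
     (\<forall>x\<in>B. \<forall>y\<in>B. x * y \<in> B) \<and> (\<forall>x\<in>B. star x \<in> B) \<and> closed B"

definition cstar_generated :: "'a :: cstar_algebra set \<Rightarrow> 'a set" where
  "cstar_generated S = cstar_subalgebra hull S"

definition star_hom_on ::
    "'b :: cstar_algebra set \<Rightarrow> ('b \<Rightarrow> 'a :: cstar_algebra) \<Rightarrow> bool" where
  "star_hom_on B f \<longleftrightarrow>
     (\<forall>x\<in>B. \<forall>y\<in>B. f (x + y) = f x + f y) \<and>
     (\<forall>c. \<forall>x\<in>B. f (c *\<^sub>C x) = c *\<^sub>C f x) \<and>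
     (\<forall>x\<in>B. \<forall>y\<in>B. f (x * y) = f x * f y) \<and>
     (\<forall>x\<in>B. f (star x) = star (f x))"

definition finite_dimensional :: "'b :: cstar_algebra set \<Rightarrow> bool" where
  "finite_dimensional B \<longleftrightarrow> (\<exists>F. finite F \<and> B \<subseteq> complex_vector.span F)"


section \<open>Inductive limits and AF-algebras\<close>

text \<open>
  The algebras of an inductive system are C*-subalgebras \<^term>\<open>B i\<close> of one ambient C*-algebra
  \<^typ>\<open>'b\<close>. This is only a way of having algebras of different dimensions in one type:
  the connecting maps \<^term>\<open>\<phi> i j\<close> (for \<^term>\<open>le i j\<close>) are arbitrary *-homomorphisms
  between them, unrelated to the inclusions into \<^typ>\<open>'b\<close>. No generality is lost for
  finite-dimensional algebras, since each of them is isomorphic to a C*-subalgebra of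
  the compact operators on a separable infinite-dimensional Hilbert space.
\<close>

definition cstar_inductive_system ::
    "'i set \<Rightarrow> ('i \<Rightarrow> 'i \<Rightarrow> bool) \<Rightarrow> ('i \<Rightarrow> 'b :: cstar_algebra set) \<Rightarrow> ('i \<Rightarrow> 'i \<Rightarrow> 'b \<Rightarrow> 'b) \<Rightarrow> bool"
where
  "cstar_inductive_system I le B \<phi> \<longleftrightarrow>
     I \<noteq> {} \<and>
     (\<forall>i\<in>I. le i i) \<and>
     (\<forall>i\<in>I. \<forall>j\<in>I. \<forall>k\<in>I. le i j \<longrightarrow> le j k \<longrightarrow> le i k) \<and>
     (\<forall>i\<in>I. \<forall>j\<in>I. \<exists>k\<in>I. le i k \<and> le j k) \<and>
     (\<forall>i\<in>I. cstar_subalgebra (B i)) \<and>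
     (\<forall>i\<in>I. \<forall>j\<in>I. le i j \<longrightarrow> \<phi> i j ` B i \<subseteq> B j \<and> star_hom_on (B i) (\<phi> i j)) \<and>
     (\<forall>i\<in>I. \<forall>x\<in>B i. \<phi> i i x = x) \<and>
     (\<forall>i\<in>I. \<forall>j\<in>I. \<forall>k\<in>I. le i j \<longrightarrow> le j k \<longrightarrow> (\<forall>x\<in>B i. \<phi> j k (\<phi> i j x) = \<phi> i k x))"

text \<open>
  The inductive limit in the category of C*-algebras is the Hausdorff completion of the algebraic
  direct limit with respect to the C*-seminorm sending the class of \<^term>\<open>x \<in> B i\<close> to the limit
  of the (decreasing, as *-homomorphisms are contractive) net of the norms of the
  \<^term>\<open>\<phi> i j x\<close>. An isomorphism from this completion to \<^typ>\<open>'a\<close> is the same as a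
  compatible family of *-homomorphisms \<^term>\<open>\<psi> i\<close> into \<^typ>\<open>'a\<close> that realises this
  seminorm and has jointly dense range.
\<close>

definition is_inductive_limit ::
    "'i set \<Rightarrow> ('i \<Rightarrow> 'i \<Rightarrow> bool) \<Rightarrow> ('i \<Rightarrow> 'b :: cstar_algebra set) \<Rightarrow> ('i \<Rightarrow> 'i \<Rightarrow> 'b \<Rightarrow> 'b) \<Rightarrow>
      ('i \<Rightarrow> 'b \<Rightarrow> 'a :: cstar_algebra) \<Rightarrow> bool"
where
  "is_inductive_limit I le B \<phi> \<psi> \<longleftrightarrow>
     (\<forall>i\<in>I. star_hom_on (B i) (\<psi> i)) \<and>
     (\<forall>i\<in>I. \<forall>j\<in>I. le i j \<longrightarrow> (\<forall>x\<in>B i. \<psi> j (\<phi> i j x) = \<psi> i x)) \<and>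
     (\<forall>i\<in>I. \<forall>x\<in>B i. norm (\<psi> i x) = (INF j\<in>{j\<in>I. le i j}. norm (\<phi> i j x))) \<and>
     closure (\<Union>i\<in>I. \<psi> i ` B i) = UNIV"

text \<open>
  The index type \<^typ>\<open>'i\<close> and the ambient type \<^typ>\<open>'b\<close> have to be parameters, because
  one cannot quantify over types inside a definition. A theorem assuming \<open>AF_algebra\<close> with type
  variables for them covers inductive limits over all directed sets.
\<close>

definition AF_algebra ::
    "'i itself \<Rightarrow> 'b :: cstar_algebra itself \<Rightarrow> 'a :: cstar_algebra itself \<Rightarrow> bool"
where
  "AF_algebra _ _ _ \<longleftrightarrow>
     (\<exists>(I :: 'i set) le (B :: 'i \<Rightarrow> 'b set) \<phi> (\<psi> :: 'i \<Rightarrow> 'b \<Rightarrow> 'a).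
        cstar_inductive_system I le B \<phi> \<and> (\<forall>i\<in>I. finite_dimensional (B i)) \<and>
        is_inductive_limit I le B \<phi> \<psi>)"


section \<open>The minimal unitization\<close>

definition is_unit_element :: "'a :: cstar_algebra \<Rightarrow> bool" where
  "is_unit_element e \<longleftrightarrow> (\<forall>x. e * x = x \<and> x * e = x)"

text \<open>
  \<open>Unitize (a, l)\<close> is \<open>a + l 1\<close>. If \<^typ>\<open>'a\<close> is unital (the zero algebra counts as
  unital), then only \<open>l = 0\<close> is allowed, so that the unitization is \<^typ>\<open>'a\<close> itself.
\<close>

typedef (overloaded) 'a unitization =
  "{(a, l) | (a :: 'a :: cstar_algebra) (l :: complex). (\<exists>e :: 'a. is_unit_element e) \<longrightarrow> l = 0}"
  morphisms components Unitize
  by (intro exI[of _ "(0, 0)"]) auto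

setup_lifting type_definition_unitization

lemma bounded_linear_scaleC: "bounded_linear (\<lambda>x :: 'a :: cstar_algebra. c *\<^sub>C x)"
  by (rule bounded_linear_intro[where K = "cmod c"])
    (simp_all add: scaleC_add_right scaleR_scaleC scaleC_scaleC mult.commute norm_scaleC)

lemma bounded_linear_unitization:
  "bounded_linear (\<lambda>x :: 'a :: cstar_algebra. a * x + l *\<^sub>C x)"
  by (intro bounded_linear_add bounded_linear_mult_right bounded_linear_scaleC)

definition left_norm :: "'a :: cstar_algebra \<Rightarrow> complex \<Rightarrow> real" where
  "left_norm a l = onorm (\<lambda>x. a * x + l *\<^sub>C x)"

lemma star_zero [simp]: "star (0 :: 'a :: cstar_algebra) = 0"
  using star_add[of "0 :: 'a" 0] by simp

lemma norm_star [simp]: "norm (star x) = norm (x :: 'a :: cstar_algebra)"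
proof -
  have *: "norm x \<le> norm (star x)" for x :: 'a
  proof (cases "x = 0")
    case False
    have "(norm x)\<^sup>2 \<le> norm (star x) * norm x"
      by (metis cstar_identity norm_mult_ineq)
    then show ?thesis using False by (simp add: power2_eq_square)
  qed simp
  show ?thesis using *[of x] *[of "star x"] by (simp add: star_star)
qed

lemma left_norm_bound: "norm (a * x + l *\<^sub>C x) \<le> left_norm a l * norm x"
  unfolding left_norm_def by (rule onorm[OF bounded_linear_unitization])

lemma left_norm_nonneg: "0 \<le> left_norm a l"
  unfolding left_norm_def by (rule onorm_pos_le[OF bounded_linear_unitization])

lemma left_norm_leI:
  "(\<And>x. norm (a * x + l *\<^sub>C x) \<le> b * norm x) \<Longrightarrow> 0 \<le> b \<Longrightarrow> left_norm a l \<le> b"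
  unfolding left_norm_def by (rule onorm_bound) auto

lemma left_norm_zero_right [simp]: "left_norm a 0 = norm a"
proof (rule antisym)
  show "left_norm a 0 \<le> norm a"
    by (rule left_norm_leI) (simp_all add: norm_mult_ineq)
  show "norm a \<le> left_norm a 0"
  proof (cases "a = 0")
    case False
    have "norm a * norm a = norm (a * star a)"
      using cstar_identity[of "star a"] by (simp add: star_star power2_eq_square)
    also have "\<dots> \<le> left_norm a 0 * norm a"
      using left_norm_bound[of a "star a" 0] by simp
    finally show ?thesis using False by simp
  qed (simp add: left_norm_nonneg)
qed

lemma left_norm_add: "left_norm (a + b) (l + m) \<le> left_norm a l + left_norm b m"
proof (rule left_norm_leI)
  fix x
  have "norm ((a + b) * x + (l + m) *\<^sub>C x) = norm ((a * x + l *\<^sub>C x) + (b * x + m *\<^sub>C x))"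
    by (simp add: algebra_simps scaleC_add_left)
  also have "\<dots> \<le> left_norm a l * norm x + left_norm b m * norm x"
    by (intro norm_triangle_le add_mono left_norm_bound)
  finally show "norm ((a + b) * x + (l + m) *\<^sub>C x) \<le> (left_norm a l + left_norm b m) * norm x"
    by (simp add: algebra_simps)
qed (simp add: left_norm_nonneg)

lemma left_norm_mult:
  "left_norm (a * b + l *\<^sub>C b + m *\<^sub>C a) (l * m) \<le> left_norm a l * left_norm b m"
proof (rule left_norm_leI)
  fix x
  have "norm ((a * b + l *\<^sub>C b + m *\<^sub>C a) * x + (l * m) *\<^sub>C x) =
        norm (a * (b * x + m *\<^sub>C x) + l *\<^sub>C (b * x + m *\<^sub>C x))"
    by (simp add: algebra_simps scaleC_add_right mult_scaleC_left mult_scaleC_right scaleC_scaleC)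
  also have "\<dots> \<le> left_norm a l * (left_norm b m * norm x)"
    by (rule order_trans[OF left_norm_bound mult_left_mono])
      (simp_all add: left_norm_bound left_norm_nonneg)
  finally show "norm ((a * b + l *\<^sub>C b + m *\<^sub>C a) * x + (l * m) *\<^sub>C x)
      \<le> left_norm a l * left_norm b m * norm x"
    by (simp add: algebra_simps)
qed (simp add: left_norm_nonneg)

lemma left_norm_scaleC_le: "left_norm (c *\<^sub>C a) (c * l) \<le> cmod c * left_norm a l"
proof (rule left_norm_leI)
  fix x
  have "norm ((c *\<^sub>C a) * x + (c * l) *\<^sub>C x) = cmod c * norm (a * x + l *\<^sub>C x)"
    by (simp add: mult_scaleC_left scaleC_add_right scaleC_scaleC flip: norm_scaleC)
  also have "\<dots> \<le> cmod c * (left_norm a l * norm x)"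
    by (intro mult_left_mono left_norm_bound) simp
  finally show "norm ((c *\<^sub>C a) * x + (c * l) *\<^sub>C x) \<le> cmod c * left_norm a l * norm x"
    by (simp add: algebra_simps)
qed (simp add: left_norm_nonneg)

lemma left_norm_zero [simp]: "left_norm 0 0 = 0"
  by simp

lemma left_norm_scaleC: "left_norm (c *\<^sub>C a) (c * l) = cmod c * left_norm a l"
proof (cases "c = 0")
  case True
  then show ?thesis by simp
next
  case False
  have "left_norm (inverse c *\<^sub>C (c *\<^sub>C a)) (inverse c * (c * l))
      \<le> cmod (inverse c) * left_norm (c *\<^sub>C a) (c * l)"
    by (rule left_norm_scaleC_le)
  moreover have "inverse c *\<^sub>C (c *\<^sub>C a) = a" "inverse c * (c * l) = l"
    using False by (simp_all add: scaleC_scaleC scaleC_one)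
  ultimately have "left_norm a l \<le> cmod (inverse c) * left_norm (c *\<^sub>C a) (c * l)"
    by (simp only:)
  then have "cmod c * left_norm a l \<le> cmod c * (cmod (inverse c) * left_norm (c *\<^sub>C a) (c * l))"
    by (rule mult_left_mono) simp
  also have "\<dots> = left_norm (c *\<^sub>C a) (c * l)"
    using False by (simp add: norm_inverse)
  finally show ?thesis by (rule antisym[OF left_norm_scaleC_le])
qed

lemma left_norm_cstar_le:
  "(left_norm a l)\<^sup>2 \<le> left_norm (star a * a + cnj l *\<^sub>C a + l *\<^sub>C star a) (cnj l * l)"
proof -
  let ?b = "star a * a + cnj l *\<^sub>C a + l *\<^sub>C star a"
  let ?N = "left_norm ?b (cnj l * l)"
  have "left_norm a l \<le> sqrt ?N"
  proof (rule left_norm_leI)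
    fix x
    let ?y = "a * x + l *\<^sub>C x"
    have "(norm ?y)\<^sup>2 = norm (star ?y * ?y)" by (simp add: cstar_identity)
    also have "star ?y * ?y = star x * (?b * x + (cnj l * l) *\<^sub>C x)"
      by (simp add: star_add star_mult star_scaleC algebra_simps scaleC_add_right
          mult_scaleC_left mult_scaleC_right scaleC_scaleC)
    also have "norm \<dots> \<le> norm x * (?N * norm x)"
      by (rule order_trans[OF norm_mult_ineq]) (simp add: mult_left_mono left_norm_bound)
    also have "\<dots> = (sqrt ?N * norm x)\<^sup>2"
      by (simp add: power_mult_distrib left_norm_nonneg power2_eq_square algebra_simps)
    finally show "norm ?y \<le> sqrt ?N * norm x"
      by (rule power2_le_imp_le) (simp add: left_norm_nonneg)
  qed (simp add: left_norm_nonneg)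
  then have "(left_norm a l)\<^sup>2 \<le> (sqrt ?N)\<^sup>2"
    by (rule power_mono) (rule left_norm_nonneg)
  then show ?thesis by (simp add: left_norm_nonneg)
qed

lemma left_norm_star_le: "left_norm a l \<le> left_norm (star a) (cnj l)"
proof (cases "left_norm a l = 0")
  case False
  have "(left_norm a l)\<^sup>2 \<le> left_norm (star a * a + cnj l *\<^sub>C a + l *\<^sub>C star a) (cnj l * l)"
    by (rule left_norm_cstar_le)
  also have "\<dots> \<le> left_norm (star a) (cnj l) * left_norm a l"
    by (rule left_norm_mult)
  finally show ?thesis
    using False left_norm_nonneg[of a l] by (simp add: power2_eq_square)
qed (simp add: left_norm_nonneg)

lemma left_norm_star: "left_norm (star a) (cnj l) = left_norm a l"
  using left_norm_star_le[of a l] left_norm_star_le[of "star a" "cnj l"] by (simp add: star_star)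

lemma left_norm_cstar:
  "left_norm (star a * a + cnj l *\<^sub>C a + l *\<^sub>C star a) (cnj l * l) = (left_norm a l)\<^sup>2"
  using left_norm_cstar_le[of a l] left_norm_mult[of "star a" a "cnj l" l] left_norm_star[of a l]
  by (simp add: power2_eq_square)

lemma left_norm_eq_0_imp:
  fixes a :: "'a :: cstar_algebra"
  assumes "left_norm a l = 0" and "(\<exists>e :: 'a. is_unit_element e) \<longrightarrow> l = 0"
  shows "a = 0 \<and> l = 0"
proof -
  have "l = 0"
  proof (rule ccontr)
    assume l: "l \<noteq> 0"
    define e where "e = (- inverse l) *\<^sub>C a"
    have ex: "e * x = x" for x
    proof -
      have "a * x + l *\<^sub>C x = 0" using left_norm_bound[of a x l] assms(1) by simp
      then have "a * x = (- l) *\<^sub>C x" by (simp add: eq_neg_iff_add_eq_0)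
      then show ?thesis using l by (simp add: e_def mult_scaleC_left scaleC_scaleC scaleC_one)
    qed
    have xs: "x * star e = x" for x
      using ex[of "star x"] by (metis star_mult star_star)
    have "star e = e" using ex[of "star e"] xs[of e] by simp
    then have "is_unit_element e" using ex xs by (simp add: is_unit_element_def)
    then show False using assms(2) l by blast
  qed
  with assms(1) show ?thesis by simp
qed

lemma left_norm_minus: "left_norm (a - b) (l - m) \<le> left_norm a l + left_norm b m"
proof -
  have "left_norm (- b) (- m) = left_norm b m"
    using left_norm_scaleC[of "-1" b m] by (simp add: scaleC_one)
  then show ?thesis using left_norm_add[of a "- b" l "- m"] by simp
qed

lemma cmod_le_left_norm:
  "\<exists>d>0. \<forall>(a :: 'a :: cstar_algebra) l.
     ((\<exists>e :: 'a. is_unit_element e) \<longrightarrow> l = 0) \<longrightarrow> d * cmod l \<le> left_norm a l"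
proof (cases "\<exists>e :: 'a. is_unit_element e")
  case True
  then show ?thesis by (intro exI[of _ 1]) (simp add: left_norm_nonneg)
next
  case False
  have "\<exists>d>0. \<forall>b :: 'a. d \<le> left_norm b 1"
  proof (rule ccontr)
    assume contra: "\<not> ?thesis"
    have "\<exists>b :: 'a. left_norm b 1 < inverse (real (Suc n))" for n
      using contra by (metis inverse_positive_iff_positive not_le of_nat_0_less_iff zero_less_Suc)
    then obtain b :: "nat \<Rightarrow> 'a" where b: "\<And>n. left_norm (b n) 1 < inverse (real (Suc n))"
      by metis
    have diff: "norm (b n - b m) < inverse (real (Suc n)) + inverse (real (Suc m))" for n m
      using left_norm_minus[of "b n" "b m" 1 1] b[of n] b[of m] by simp
    have "Cauchy b"
    proof (rule metric_CauchyI)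
      fix e :: real assume "e > 0"
      then obtain N where N: "inverse (real (Suc N)) < e / 2"
        using reals_Archimedean[of "e / 2"] by auto
      have "inverse (real (Suc n)) \<le> inverse (real (Suc N))" if "n \<ge> N" for n
        using that by (simp add: le_imp_inverse_le)
      then have "dist (b m) (b n) < e" if "m \<ge> N" "n \<ge> N" for m n
        using diff[of m n] N that by (smt (verit) dist_norm field_sum_of_halves)
      then show "\<exists>M. \<forall>m\<ge>M. \<forall>n\<ge>M. dist (b m) (b n) < e" by blast
    qed
    then obtain c where c: "b \<longlonglongrightarrow> c" using Cauchy_convergent_iff convergent_def by blast
    have "left_norm c 1 \<le> norm (c - b n) + inverse (real (Suc n))" for n
      using left_norm_add[of "c - b n" "b n" 0 1] b[of n] by simp
    moreover have "(\<lambda>n. norm (c - b n) + inverse (real (Suc n))) \<longlonglongrightarrow> norm (c - c) + 0"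
      by (intro tendsto_intros c LIMSEQ_inverse_real_of_nat)
    ultimately have "left_norm c 1 \<le> 0"
      by (intro LIMSEQ_le_const[of _ 0]) auto
    then have "left_norm c 1 = 0" using left_norm_nonneg[of c 1] by simp
    then show False using left_norm_eq_0_imp[of c 1] False by auto
  qed
  then obtain d where d: "d > 0" "\<And>b :: 'a. d \<le> left_norm b 1" by blast
  have "d * cmod l \<le> left_norm a l" for a :: 'a and l
  proof (cases "l = 0")
    case l: False
    have "left_norm a l = cmod l * left_norm (inverse l *\<^sub>C a) 1"
      using left_norm_scaleC[of l "inverse l *\<^sub>C a" 1] l by (simp add: scaleC_scaleC scaleC_one)
    then show ?thesis using mult_left_mono[OF d(2)[of "inverse l *\<^sub>C a"], of "cmod l"]
      by (simp add: mult.commute)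
  qed (simp add: left_norm_nonneg)
  then show ?thesis using d(1) by blast
qed

instantiation unitization :: (cstar_algebra) real_algebra
begin

lift_definition zero_unitization :: "'a unitization" is "(0, 0)" by auto
lift_definition plus_unitization :: "'a unitization \<Rightarrow> 'a unitization \<Rightarrow> 'a unitization"
  is "\<lambda>(a, l) (b, m). (a + b, l + m)" by auto
lift_definition minus_unitization :: "'a unitization \<Rightarrow> 'a unitization \<Rightarrow> 'a unitization"
  is "\<lambda>(a, l) (b, m). (a - b, l - m)" by auto
lift_definition uminus_unitization :: "'a unitization \<Rightarrow> 'a unitization"
  is "\<lambda>(a, l). (- a, - l)" by auto
lift_definition times_unitization :: "'a unitization \<Rightarrow> 'a unitization \<Rightarrow> 'a unitization"
  is "\<lambda>(a, l) (b, m). (a * b + l *\<^sub>C b + m *\<^sub>C a, l * m)" by auto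
lift_definition scaleR_unitization :: "real \<Rightarrow> 'a unitization \<Rightarrow> 'a unitization"
  is "\<lambda>r (a, l). (complex_of_real r *\<^sub>C a, complex_of_real r * l)" by auto

instance
proof
  fix x y z :: "'a unitization" and r s :: real
  show "x + y + z = x + (y + z)" by transfer (auto simp: algebra_simps)
  show "x + y = y + x" by transfer (auto simp: algebra_simps)
  show "0 + x = x" by transfer auto
  show "- x + x = 0" by transfer auto
  show "x - y = x + - y" by transfer auto
  show "r *\<^sub>R (x + y) = r *\<^sub>R x + r *\<^sub>R y"
    by transfer (auto simp: scaleC_add_right algebra_simps)
  show "(r + s) *\<^sub>R x = r *\<^sub>R x + s *\<^sub>R x"
    by transfer (auto simp: scaleC_add_left algebra_simps)
  show "r *\<^sub>R s *\<^sub>R x = (r * s) *\<^sub>R x" by transfer (auto simp: scaleC_scaleC)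
  show "1 *\<^sub>R x = x" by transfer auto
  show "x * y * z = x * (y * z)"
    by transfer (auto simp: algebra_simps scaleC_add_right mult_scaleC_left mult_scaleC_right
        scaleC_scaleC)
  show "(x + y) * z = x * z + y * z"
    by transfer (auto simp: algebra_simps scaleC_add_right scaleC_add_left)
  show "x * (y + z) = x * y + x * z"
    by transfer (auto simp: algebra_simps scaleC_add_right scaleC_add_left)
  show "r *\<^sub>R x * y = r *\<^sub>R (x * y)"
    by transfer (auto simp: algebra_simps scaleC_add_right mult_scaleC_left scaleC_scaleC)
  show "x * r *\<^sub>R y = r *\<^sub>R (x * y)"
    by transfer (auto simp: algebra_simps scaleC_add_right mult_scaleC_right scaleC_scaleC)
qed

end

instantiation unitization :: (cstar_algebra) real_normed_algebra
begin

lift_definition norm_unitization :: "'a unitization \<Rightarrow> real"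
  is "\<lambda>(a, l). left_norm a l" .

definition dist_unitization :: "'a unitization \<Rightarrow> 'a unitization \<Rightarrow> real" where
  "dist_unitization x y = norm (x - y)"
definition sgn_unitization :: "'a unitization \<Rightarrow> 'a unitization" where
  "sgn_unitization x = scaleR (inverse (norm x)) x"
definition uniformity_unitization :: "('a unitization \<times> 'a unitization) filter" where
  "uniformity_unitization = (INF e\<in>{0 <..}. principal {(x, y). dist x y < e})"
definition open_unitization :: "'a unitization set \<Rightarrow> bool" where
  "open_unitization S \<longleftrightarrow> (\<forall>x\<in>S. \<forall>\<^sub>F (x', y) in uniformity. x' = x \<longrightarrow> y \<in> S)"

instance
proof
  fix x y :: "'a unitization" and r :: real
  show "dist x y = norm (x - y)" by (rule dist_unitization_def)
  show "sgn x = x /\<^sub>R norm x" by (rule sgn_unitization_def)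
  show "(uniformity :: ('a unitization \<times> 'a unitization) filter) =
      (INF e\<in>{0 <..}. principal {(x, y). dist x y < e})"
    by (rule uniformity_unitization_def)
  show "open U \<longleftrightarrow> (\<forall>x\<in>U. \<forall>\<^sub>F (x', y) in uniformity. x' = x \<longrightarrow> y \<in> U)"
    for U :: "'a unitization set"
    by (rule open_unitization_def)
  show "norm x = 0 \<longleftrightarrow> x = 0" by transfer (use left_norm_eq_0_imp in fastforce)
  show "norm (x + y) \<le> norm x + norm y" by transfer (auto simp: left_norm_add)
  show "norm (r *\<^sub>R x) = \<bar>r\<bar> * norm x"
    by (simp only: norm_unitization.rep_eq scaleR_unitization.rep_eq)
      (simp add: case_prod_beta left_norm_scaleC)
  show "norm (x * y) \<le> norm x * norm y" by transfer (auto simp: left_norm_mult)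
qed

end

instance unitization :: (cstar_algebra) banach
proof
  fix X :: "nat \<Rightarrow> 'a unitization"
  assume X: "Cauchy X"
  define a l where "a n = fst (components (X n))" and "l n = snd (components (X n))" for n
  have l0: "(\<exists>e :: 'a. is_unit_element e) \<longrightarrow> l n = 0" for n
    using components[of "X n"] by (auto simp: l_def)
  have diff: "norm (X m - X n) = left_norm (a m - a n) (l m - l n)" for m n
    unfolding a_def l_def norm_unitization.rep_eq minus_unitization.rep_eq
    by (simp add: case_prod_beta)
  obtain d where d: "d > 0"
    and d': "\<forall>(b :: 'a) m. ((\<exists>e :: 'a. is_unit_element e) \<longrightarrow> m = 0) \<longrightarrow> d * cmod m \<le> left_norm b m"
    using cmod_le_left_norm[where 'a = 'a] by (elim exE conjE)
  have dl: "d * cmod (l m - l n) \<le> norm (X m - X n)" for m n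
    unfolding diff using l0[of m] l0[of n] d'[rule_format, of "l m - l n"] by simp
  have "Cauchy l"
  proof (rule metric_CauchyI)
    fix e :: real assume "e > 0"
    with d have "d * e > 0" by simp
    then obtain M where M: "\<And>m n. m \<ge> M \<Longrightarrow> n \<ge> M \<Longrightarrow> dist (X m) (X n) < d * e"
      using metric_CauchyD[OF X] by blast
    have "dist (l m) (l n) < e" if "m \<ge> M" "n \<ge> M" for m n
    proof -
      have "d * cmod (l m - l n) < d * e"
        using M[OF that] dl[of m n] by (simp add: dist_norm)
      then show ?thesis using d by (simp add: dist_norm)
    qed
    then show "\<exists>M. \<forall>m\<ge>M. \<forall>n\<ge>M. dist (l m) (l n) < e" by blast
  qed
  then obtain l' where l': "l \<longlonglongrightarrow> l'" using Cauchy_convergent_iff convergent_def by blast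
  have l'0: "(\<exists>e :: 'a. is_unit_element e) \<longrightarrow> l' = 0"
  proof
    assume "\<exists>e :: 'a. is_unit_element e"
    then have "l = (\<lambda>_. 0)" using l0 by auto
    then show "l' = 0" using l' by (simp add: LIMSEQ_const_iff)
  qed
  have one: "left_norm (0 :: 'a) c \<le> cmod c" for c
    by (rule left_norm_leI) (simp_all add: norm_scaleC)
  have da: "norm (a m - a n) \<le> norm (X m - X n) + cmod (l m - l n)" for m n
    using left_norm_minus[of "a m - a n" 0 "l m - l n" "l m - l n"] one[of "l m - l n"] diff[of m n]
    by simp
  have "Cauchy a"
  proof (rule metric_CauchyI)
    fix e :: real assume "e > 0"
    then have e2: "e / 2 > 0" by simp
    obtain M where M: "\<And>m n. m \<ge> M \<Longrightarrow> n \<ge> M \<Longrightarrow> dist (X m) (X n) < e / 2"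
      using metric_CauchyD[OF X e2] by blast
    obtain N where N: "\<And>m n. m \<ge> N \<Longrightarrow> n \<ge> N \<Longrightarrow> dist (l m) (l n) < e / 2"
      using metric_CauchyD[OF \<open>Cauchy l\<close> e2] by blast
    have "dist (a m) (a n) < e" if "m \<ge> max M N" "n \<ge> max M N" for m n
      using M[of m n] N[of m n] that da[of m n] by (simp add: dist_norm)
    then show "\<exists>M. \<forall>m\<ge>M. \<forall>n\<ge>M. dist (a m) (a n) < e" by blast
  qed
  then obtain a' where a': "a \<longlonglongrightarrow> a'" using Cauchy_convergent_iff convergent_def by blast
  let ?x = "Unitize (a', l')"
  have comp: "components ?x = (a', l')"
    using l'0 by (intro Unitize_inverse) auto
  have "norm (X n - ?x) \<le> norm (a n - a') + cmod (l n - l')" for n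
  proof -
    have "norm (X n - ?x) = left_norm (a n - a') (l n - l')"
      unfolding a_def l_def norm_unitization.rep_eq minus_unitization.rep_eq comp
      by (simp add: case_prod_beta)
    also have "\<dots> \<le> norm (a n - a') + cmod (l n - l')"
      using left_norm_add[of "a n - a'" 0 0 "l n - l'"] one[of "l n - l'"] by simp
    finally show ?thesis .
  qed
  then have "\<forall>\<^sub>F n in sequentially. norm (X n - ?x) \<le> norm (a n - a') + cmod (l n - l')"
    by (rule always_eventually[OF allI])
  moreover have "(\<lambda>n. norm (a n - a') + cmod (l n - l')) \<longlonglongrightarrow> 0"
    using tendsto_add[OF tendsto_norm[OF LIM_zero[OF a']] tendsto_norm[OF LIM_zero[OF l']]] by simp
  ultimately have "(\<lambda>n. X n - ?x) \<longlonglongrightarrow> 0"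
    by (rule Lim_null_comparison)
  then have "X \<longlonglongrightarrow> ?x" by (rule LIM_zero_cancel)
  then show "convergent X" by (rule convergentI)
qed

instantiation unitization :: (cstar_algebra) cstar_algebra
begin

lift_definition scaleC_unitization :: "complex \<Rightarrow> 'a unitization \<Rightarrow> 'a unitization"
  is "\<lambda>c (a, l). (c *\<^sub>C a, c * l)" by auto
lift_definition star_unitization :: "'a unitization \<Rightarrow> 'a unitization"
  is "\<lambda>(a, l). (star a, cnj l)" by auto

instance
proof
  fix x y z :: "'a unitization" and r :: real and c d :: complex
  show "r *\<^sub>R x = complex_of_real r *\<^sub>C x" by transfer auto
  show "c *\<^sub>C (x + y) = c *\<^sub>C x + c *\<^sub>C y"
    by transfer (auto simp: scaleC_add_right algebra_simps)
  show "(c + d) *\<^sub>C x = c *\<^sub>C x + d *\<^sub>C x"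
    by transfer (auto simp: scaleC_add_left algebra_simps)
  show "c *\<^sub>C d *\<^sub>C x = (c * d) *\<^sub>C x" by transfer (auto simp: scaleC_scaleC)
  show "c *\<^sub>C x * y = c *\<^sub>C (x * y)"
    by transfer (auto simp: algebra_simps scaleC_add_right mult_scaleC_left scaleC_scaleC)
  show "x * c *\<^sub>C y = c *\<^sub>C (x * y)"
    by transfer (auto simp: algebra_simps scaleC_add_right mult_scaleC_right scaleC_scaleC)
  show "norm (c *\<^sub>C x) = cmod c * norm x" by transfer (auto simp: left_norm_scaleC)
  show "star (star x) = x" by transfer (auto simp: star_star)
  show "star (x + y) = star x + star y" by transfer (auto simp: star_add)
  show "star (c *\<^sub>C x) = cnj c *\<^sub>C star x" by transfer (auto simp: star_scaleC)
  show "star (x * y) = star y * star x"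
    by transfer (auto simp: star_add star_mult star_scaleC algebra_simps)
  show "norm (star x * x) = (norm x)\<^sup>2"
    by transfer (auto simp: left_norm_cstar)
qed

end

lemma unitization_unital: "\<exists>e :: 'a :: cstar_algebra unitization. is_unit_element e"
proof -
  have "\<exists>u :: 'a unitization. \<forall>x. components (u * x) = components x \<and> components (x * u) = components x"
  proof (cases "\<exists>e :: 'a. is_unit_element e")
    case True
    then obtain e :: 'a where e: "\<And>x. e * x = x" "\<And>x. x * e = x"
      by (auto simp: is_unit_element_def)
    have u: "components (Unitize (e, 0)) = (e, 0)" by (intro Unitize_inverse) auto
    have "snd (components x) = 0" for x :: "'a unitization"
      using components[of x] True by auto
    then show ?thesis
      by (intro exI[of _ "Unitize (e, 0)"])
        (simp add: times_unitization.rep_eq u e case_prod_beta prod_eq_iff)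
  next
    case False
    then have u: "components (Unitize (0 :: 'a, 1)) = (0, 1)" by (intro Unitize_inverse) auto
    show ?thesis
      by (intro exI[of _ "Unitize (0, 1)"])
        (simp add: times_unitization.rep_eq u case_prod_beta)
  qed
  then show ?thesis by (simp add: is_unit_element_def components_inject)
qed

lemma norm_unitization_embedding:
  "norm (Unitize (a :: 'a :: cstar_algebra, 0)) = norm a"
proof -
  have "components (Unitize (a, 0)) = (a, 0)" by (intro Unitize_inverse) auto
  then show ?thesis by (simp add: norm_unitization.rep_eq)
qed


section \<open>The generator rank\<close>

definition generation_property :: "nat \<Rightarrow> 'a :: cstar_algebra itself \<Rightarrow> bool" where
  "generation_property n _ \<longleftrightarrow>
     (\<forall>(a :: nat \<Rightarrow> 'a) \<epsilon> c. (\<forall>j\<le>n. self_adjoint (a j)) \<longrightarrow> \<epsilon> > 0 \<longrightarrow>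
        (\<exists>b :: nat \<Rightarrow> 'a. (\<forall>j\<le>n. self_adjoint (b j) \<and> norm (b j - a j) < \<epsilon>) \<and>
           (\<exists>g \<in> cstar_generated (b ` {..n}). norm (c - g) < \<epsilon>)))"

definition gr0 :: "'a :: cstar_algebra itself \<Rightarrow> enat" where
  "gr0 A = (if \<exists>n. generation_property n A then enat (LEAST n. generation_property n A) else \<infinity>)"

definition generator_rank :: "'a :: cstar_algebra itself \<Rightarrow> enat" where
  "generator_rank _ = gr0 TYPE('a unitization)"

end

theory Submission
  imports Defs "HOL-Computational_Algebra.Fundamental_Theorem_Algebra"
begin

text \<open>
  Elements \<open>a\<close> such that \<open>C*(a)\<close> comes within \<open>\<epsilon>\<close> of a given \<open>c\<close> form an open set, because
  *-polynomials are continuous. By Baire's theorem it suffices that this set is dense, and in an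
  AF-algebra this reduces to the density of single generators in a finite-dimensional \<open>F\<close>.
  There, write \<open>a = h + \<i> k\<close> with \<open>h\<close>, \<open>k\<close> self-adjoint. An orthogonal family of
  minimal projections diagonalises \<open>h\<close>; perturb \<open>h\<close> to have distinct nonzero eigenvalues and \<open>k\<close>
  to have a nonzero corner \<open>p k q\<close> whenever \<open>p F q \<noteq> 0\<close>. Then \<open>h\<close> generates every \<open>p\<close>, and
  as each \<open>p F q\<close> is at most one-dimensional, the corners of \<open>k\<close> span the rest of \<open>F\<close>. The
  approximation by finite-dimensional subalgebras passes to the unitization, which gives the bound
  on the generator rank: with \<open>h + \<i> k\<close>, the pair \<open>h\<close>, \<open>k\<close> generates.
\<close>

section \<open>The adjoint, and subalgebras that need not be closed\<close>

lemmas scaleC_zero_left [simp] = complex_vector.scale_zero_left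
  and scaleC_zero_right [simp] = complex_vector.scale_zero_right
  and scaleC_diff_right = complex_vector.scale_right_diff_distrib
  and scaleC_diff_left = complex_vector.scale_left_diff_distrib
  and scaleC_sum_right = complex_vector.scale_sum_right
  and scaleC_eq_0_iff = complex_vector.scale_eq_0_iff

lemma star_minus: "star (- x :: 'a :: cstar_algebra) = - star x"
  using star_add[of x "- x"] by (simp add: eq_neg_iff_add_eq_0 add.commute)

lemma star_diff: "star (x - y :: 'a :: cstar_algebra) = star x - star y"
  using star_add[of x "- y"] by (simp add: star_minus)

lemma star_sum: "star (\<Sum>i\<in>I. f i :: 'a :: cstar_algebra) = (\<Sum>i\<in>I. star (f i))"
  by (induction I rule: infinite_finite_induct) (simp_all add: star_add)

lemma star_mult_self_eq_0 [simp]: "star x * x = 0 \<longleftrightarrow> x = (0 :: 'a :: cstar_algebra)"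
  using cstar_identity[of x] by auto

lemma mult_star_self_eq_0 [simp]: "x * star x = 0 \<longleftrightarrow> x = (0 :: 'a :: cstar_algebra)"
  using star_mult_self_eq_0[of "star x"] by (metis star_star star_zero)

text \<open>Closedness is split off so that the finite-dimensional arguments stay algebraic; it
  returns only with \<open>cstar_generated\<close>.\<close>

definition star_subalgebra :: "'a :: cstar_algebra set \<Rightarrow> bool" where
  "star_subalgebra B \<longleftrightarrow> complex_vector.subspace B \<and>
     (\<forall>x\<in>B. \<forall>y\<in>B. x * y \<in> B) \<and> (\<forall>x\<in>B. star x \<in> B)"

lemma cstar_subalgebra_iff: "cstar_subalgebra B \<longleftrightarrow> star_subalgebra B \<and> closed B"
  by (auto simp: cstar_subalgebra_def star_subalgebra_def)

lemma star_subalgebraD: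
  assumes "star_subalgebra B"
  shows "complex_vector.subspace B" and "0 \<in> B"
    and "x \<in> B \<Longrightarrow> y \<in> B \<Longrightarrow> x + y \<in> B"
    and "x \<in> B \<Longrightarrow> y \<in> B \<Longrightarrow> x - y \<in> B"
    and "x \<in> B \<Longrightarrow> c *\<^sub>C x \<in> B"
    and "x \<in> B \<Longrightarrow> y \<in> B \<Longrightarrow> x * y \<in> B"
    and "x \<in> B \<Longrightarrow> star x \<in> B"
  using assms by (simp_all add: star_subalgebra_def complex_vector.subspace_0
      complex_vector.subspace_add complex_vector.subspace_diff complex_vector.subspace_scale)

lemma star_subalgebra_sum:
  "star_subalgebra B \<Longrightarrow> (\<And>i. i \<in> I \<Longrightarrow> f i \<in> B) \<Longrightarrow> sum f I \<in> B"
  by (simp add: star_subalgebra_def complex_vector.subspace_sum)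

lemma star_subalgebraI:
  assumes "0 \<in> B" "\<And>x y. x \<in> B \<Longrightarrow> y \<in> B \<Longrightarrow> x + y \<in> B" "\<And>c x. x \<in> B \<Longrightarrow> c *\<^sub>C x \<in> B"
    and "\<And>x y. x \<in> B \<Longrightarrow> y \<in> B \<Longrightarrow> x * y \<in> B" "\<And>x. x \<in> B \<Longrightarrow> star x \<in> B"
  shows "star_subalgebra B"
  using assms by (auto simp: star_subalgebra_def complex_vector.subspace_def)

lemma finite_dimensional_subset: "finite_dimensional B \<Longrightarrow> A \<subseteq> B \<Longrightarrow> finite_dimensional A"
  by (auto simp: finite_dimensional_def)

section \<open>Eigenvectors and minimal subspaces in finite dimension\<close>

text \<open>A member of least dimension cannot properly contain another one. This serves twice
  below: for hereditary subalgebras, and for annihilators of orthogonal families, where it replaces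
  the choice of a maximal family.\<close>

lemma minimal_subspace:
  fixes \<V> :: "'a :: cstar_algebra set set"
  assumes F: "finite_dimensional F" and ne: "\<V> \<noteq> {}"
    and \<V>: "\<And>V. V \<in> \<V> \<Longrightarrow> complex_vector.subspace V \<and> V \<subseteq> F"
  obtains V where "V \<in> \<V>" "\<And>W. W \<in> \<V> \<Longrightarrow> W \<subseteq> V \<Longrightarrow> W = V"
proof -
  obtain S where S: "finite S" "F \<subseteq> complex_vector.span S"
    using F by (auto simp: finite_dimensional_def)
  obtain V where V: "V \<in> \<V>"
    and min: "\<And>W. W \<in> \<V> \<Longrightarrow> complex_vector.dim V \<le> complex_vector.dim W"
    using ne ex_has_least_nat[of "\<lambda>V. V \<in> \<V>" _ complex_vector.dim] by blast
  have "W = V" if W: "W \<in> \<V>" "W \<subseteq> V" for W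
  proof (rule ccontr)
    assume "W \<noteq> V"
    \<comment> \<open>A basis of \<open>W\<close> together with \<open>v\<close> is independent in
      \<open>V\<close>, so \<open>W\<close> would have smaller dimension than
      \<open>V\<close>.\<close>
    then obtain v where v: "v \<in> V" "v \<notin> W" using W by blast
    obtain A where A: "A \<subseteq> W" "\<not> complex_vector.dependent A" "W \<subseteq> complex_vector.span A"
      "card A = complex_vector.dim W"
      using complex_vector.basis_exists .
    obtain B where B: "B \<subseteq> V" "\<not> complex_vector.dependent B" "V \<subseteq> complex_vector.span B"
      "card B = complex_vector.dim V"
      using complex_vector.basis_exists .
    have "finite B"
      using complex_vector.independent_span_bound[OF S(1) B(2)] B(1) S(2) \<V>[OF V] by blast
    have "complex_vector.span A \<subseteq> W"
      using A(1) \<V>[OF W(1)] by (intro complex_vector.span_minimal) auto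
    then have "v \<notin> complex_vector.span A" using v by blast
    then have "\<not> complex_vector.dependent (insert v A)"
      using A(2) by (rule complex_vector.independent_insertI)
    then have "finite (insert v A) \<and> card (insert v A) \<le> card B"
      using A(1) B(3) W v by (intro complex_vector.independent_span_bound[OF \<open>finite B\<close>]) auto
    moreover have "v \<notin> A" using A(1) v by blast
    ultimately show False using A(4) B(4) min[OF W(1)] by auto
  qed
  with V show thesis by (rule that)
qed

text \<open>More vectors than the dimension satisfy a linear relation. Its coefficients are packed
  into a polynomial, to be read as an annihilating polynomial when \<open>v i\<close> is the i-th
  power of an operator applied to a fixed vector.\<close>

lemma annihilating_polynomial:
  fixes v :: "nat \<Rightarrow> 'a :: cstar_algebra"
  assumes "finite_dimensional F" "range v \<subseteq> F"
  obtains p :: "complex poly" where "p \<noteq> 0" "(\<Sum>i\<le>degree p. coeff p i *\<^sub>C v i) = 0"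
proof -
  obtain S where S: "finite S" "F \<subseteq> complex_vector.span S"
    using assms(1) by (auto simp: finite_dimensional_def)
  note witness = that
  have *: thesis if q: "j \<le> n" "q j \<noteq> 0" "(\<Sum>i\<le>n. q i *\<^sub>C v i) = 0" for q n j
  proof -
    define p where "p = (\<Sum>i\<le>n. monom (q i) i)"
    have cf: "coeff p i = (if i \<le> n then q i else 0)" for i
      by (auto simp: p_def coeff_sum)
    have "p \<noteq> 0" using cf[of j] q by auto
    have deg: "degree p \<le> n" by (rule degree_le) (simp add: cf)
    have "(\<Sum>i\<le>degree p. coeff p i *\<^sub>C v i) = (\<Sum>i\<le>n. coeff p i *\<^sub>C v i)"
      using deg by (intro sum.mono_neutral_left) (auto simp: coeff_eq_0)
    also have "\<dots> = (\<Sum>i\<le>n. q i *\<^sub>C v i)" by (intro sum.cong) (simp_all add: cf)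
    also have "\<dots> = 0" by (rule q(3))
    finally show thesis by (rule witness[OF \<open>p \<noteq> 0\<close>])
  qed
  define n where "n = card S"
  show thesis
  \<comment> \<open>Linear dependence is a property of sets, so a repetition among the first
    \<open>n + 1\<close> terms is a separate case; it gives the relation
    \<open>v i - v j = 0\<close>.\<close>
  proof (cases "inj_on v {..n}")
    case True
    have "complex_vector.dependent (v ` {..n})"
    proof (rule ccontr)
      assume "\<not> ?thesis"
      then have "card (v ` {..n}) \<le> card S"
        using complex_vector.independent_span_bound[OF S(1), of "v ` {..n}"] assms(2) S(2) by blast
      then show False using True by (simp add: card_image n_def)
    qed
    then obtain u x where u: "x \<in> v ` {..n}" "u x \<noteq> 0" "(\<Sum>x\<in>v ` {..n}. u x *\<^sub>C x) = 0"
      using complex_vector.dependent_finite[of "v ` {..n}"] by auto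
    then obtain k where k: "k \<le> n" "x = v k" by blast
    have "(\<Sum>i\<le>n. u (v i) *\<^sub>C v i) = 0" using u(3) True by (simp add: sum.reindex)
    with k u(2) show thesis by (intro *[of k n "\<lambda>i. u (v i)"]) simp_all
  next
    case False
    then obtain i j where ij: "i \<le> n" "j \<le> n" "i \<noteq> j" "v i = v j" by (auto simp: inj_on_def)
    let ?q = "\<lambda>k. of_bool (k = i) - of_bool (k = j) :: complex"
    have "(\<Sum>k\<le>n. ?q k *\<^sub>C v k) =
        (\<Sum>k\<le>n. if k = i then v k else 0) - (\<Sum>k\<le>n. if k = j then v k else 0)"
      unfolding sum_subtractf[symmetric]
      by (intro sum.cong) (auto simp: scaleC_diff_left scaleC_one)
    also have "\<dots> = 0" using ij by simp
    finally show thesis using *[of i n ?q] ij by auto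
  qed
qed

text \<open>Split a linear factor off a polynomial of least degree that annihilates
  \<open>e\<close>: the cofactor sends \<open>e\<close> to an eigenvector for the root.\<close>

lemma ex_eigenvector:
  fixes h :: "'a :: cstar_algebra"
  assumes F: "finite_dimensional F" "complex_vector.subspace F"
    and hF: "\<And>x. x \<in> F \<Longrightarrow> h * x \<in> F" and e: "e \<in> F" "e \<noteq> 0"
  obtains z y where "y \<in> F" "y \<noteq> 0" "h * y = z *\<^sub>C y"
proof -
  \<comment> \<open>\<open>ev p\<close> is p(h) applied to \<open>e\<close>. The powers are iterated
    on \<open>e\<close> because the algebra may have no unit to serve as the zeroth power.\<close>
  define v where "v i = ((*) h ^^ i) e" for i
  define ev where "ev p = (\<Sum>i\<le>degree p. coeff p i *\<^sub>C v i)" for p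
  have v: "v i \<in> F" for i by (induction i) (auto simp: v_def e hF)
  have v_Suc: "v (Suc i) = h * v i" for i by (simp add: v_def)
  have ev: "ev p = (\<Sum>i\<le>n. coeff p i *\<^sub>C v i)" if "degree p \<le> n" for p n
    unfolding ev_def using that by (intro sum.mono_neutral_left) (auto simp: coeff_eq_0)
  have ev_factor: "ev ([:- z, 1:] * q) = h * ev q - z *\<^sub>C ev q" for z q
  proof -
    let ?n = "degree q"
    have "degree ([:- z, 1:] * q) \<le> Suc ?n"
      using degree_mult_le[of "[:- z, 1:]" q] by simp
    then have "ev ([:- z, 1:] * q) =
        (\<Sum>i\<le>Suc ?n. coeff (pCons 0 q) i *\<^sub>C v i) - z *\<^sub>C (\<Sum>i\<le>Suc ?n. coeff q i *\<^sub>C v i)"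
      by (subst ev) (simp_all add: scaleC_sum_right scaleC_scaleC sum_subtractf[symmetric]
          scaleC_diff_left[symmetric] mult_pCons_left del: sum.atMost_Suc)
    also have "(\<Sum>i\<le>Suc ?n. coeff q i *\<^sub>C v i) = ev q"
      by (rule ev[symmetric]) simp
    also have "(\<Sum>i\<le>Suc ?n. coeff (pCons 0 q) i *\<^sub>C v i) = h * ev q"
      by (subst sum.atMost_Suc_shift)
        (simp add: ev_def v_Suc sum_distrib_left mult_scaleC_right)
    finally show ?thesis .
  qed
  obtain p0 where "p0 \<noteq> 0" "ev p0 = 0"
    unfolding ev_def by (rule annihilating_polynomial[OF F(1), of v]) (use v in auto)
  then obtain p where p: "p \<noteq> 0" "ev p = 0"
    and min: "\<And>q. q \<noteq> 0 \<Longrightarrow> ev q = 0 \<Longrightarrow> degree p \<le> degree q"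
    using ex_has_least_nat[of "\<lambda>p. p \<noteq> 0 \<and> ev p = 0" p0 degree] by blast
  have "degree p \<noteq> 0"
  proof
    assume "degree p = 0"
    then have "coeff p 0 \<noteq> 0" "ev p = coeff p 0 *\<^sub>C e"
      using p(1) leading_coeff_0_iff[of p] by (auto simp: ev_def v_def)
    then show False using p(2) e by (simp add: scaleC_eq_0_iff)
  qed
  then obtain z where "poly p z = 0"
    using fundamental_theorem_of_algebra[of p] by (auto simp: constant_degree)
  then obtain q where q: "p = [:- z, 1:] * q" by (auto simp: poly_eq_0_iff_dvd dvd_def)
  have "q \<noteq> 0" using p(1) q by auto
  have "degree p = degree [:- z, 1:] + degree q"
    unfolding q using \<open>q \<noteq> 0\<close> by (intro degree_mult_eq) auto
  \<comment> \<open>\<open>q\<close> has smaller degree than \<open>p\<close>, so by minimality it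
    does not annihilate \<open>e\<close>.\<close>
  then have "ev q \<noteq> 0" using min[of q] \<open>q \<noteq> 0\<close> by auto
  moreover have "ev q \<in> F"
    unfolding ev_def using F(2) v
    by (intro complex_vector.subspace_sum complex_vector.subspace_scale)
  moreover have "h * ev q = z *\<^sub>C ev q" using p(2) q ev_factor[of z q] by simp
  ultimately show thesis using that by blast
qed

section \<open>Minimal projections\<close>

definition minimal_projection :: "'a :: cstar_algebra set \<Rightarrow> 'a \<Rightarrow> bool" where
  "minimal_projection F p \<longleftrightarrow> p \<in> F \<and> p \<noteq> 0 \<and> star p = p \<and> p * p = p \<and>
     (\<forall>x\<in>F. \<exists>c. p * x * p = c *\<^sub>C p)"

text \<open>
  A minimal hereditary *-subalgebra \<open>H \<noteq> 0\<close> is a domain, because \<open>w * H * w = H\<close> for every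
  nonzero self-adjoint \<open>w \<in> H\<close>. It is therefore one-dimensional, spanned by its unit.
\<close>

lemma ex_minimal_projection:
  fixes F :: "'a :: cstar_algebra set"
  assumes F: "star_subalgebra F" "finite_dimensional F" and ne: "x0 \<in> F" "x0 \<noteq> 0"
  obtains p where "minimal_projection F p"
proof -
  define \<V> where "\<V> = {H. star_subalgebra H \<and> H \<subseteq> F \<and> H \<noteq> {0} \<and>
    (\<forall>x\<in>H. \<forall>y\<in>F. \<forall>z\<in>H. x * y * z \<in> H)}"
  note F' = star_subalgebraD[OF F(1)]
  have "F \<in> \<V>" using F' F(1) ne by (auto simp: \<V>_def)
  then have "\<V> \<noteq> {}" by blast
  then obtain H where "H \<in> \<V>" and min: "\<And>W. W \<in> \<V> \<Longrightarrow> W \<subseteq> H \<Longrightarrow> W = H"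
    by (rule minimal_subspace[OF F(2)]) (auto simp: \<V>_def star_subalgebra_def)
  then have H: "star_subalgebra H" "H \<subseteq> F" "H \<noteq> {0}"
    and her: "\<And>x y z. x \<in> H \<Longrightarrow> y \<in> F \<Longrightarrow> z \<in> H \<Longrightarrow> x * y * z \<in> H"
    by (auto simp: \<V>_def)
  note H' = star_subalgebraD[OF H(1)]
  have compress: "\<exists>u\<in>H. x = w * u * w" if w: "w \<in> H" "w \<noteq> 0" "star w = w" and x: "x \<in> H" for w x
  proof -
    define W where "W = {w * u * w | u. u \<in> H}"
    have WI: "w * u * w \<in> W" if "u \<in> H" for u using that by (auto simp: W_def)
    have W_mult: "(w * u * w) * y * (w * u' * w) \<in> W" if "u \<in> H" "u' \<in> H" "y \<in> F" for u u' y
      using WI[of "u * (w * y * w) * u'"] that w her H' by (simp add: mult.assoc)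
    have "star_subalgebra W"
    proof (rule star_subalgebraI)
      show "0 \<in> W" using WI[of 0] H' by simp
    next
      fix x y assume "x \<in> W" "y \<in> W"
      then obtain u u' where u: "u \<in> H" "u' \<in> H" "x = w * u * w" "y = w * u' * w"
        by (auto simp: W_def)
      show "x + y \<in> W" using WI[of "u + u'"] u H' by (simp add: algebra_simps)
      show "x * y \<in> W" using WI[of "u * (w * w) * u'"] u w H' by (simp add: mult.assoc)
    next
      fix c x assume "x \<in> W"
      then obtain u where u: "u \<in> H" "x = w * u * w" by (auto simp: W_def)
      show "c *\<^sub>C x \<in> W"
        using WI[of "c *\<^sub>C u"] u H' by (simp add: mult_scaleC_left mult_scaleC_right)
      show "star x \<in> W"
        using WI[of "star u"] u w H' by (simp add: star_mult mult.assoc)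
    qed
    moreover have "W \<subseteq> H" using w H' by (auto simp: W_def)
    moreover have "W \<noteq> {0}"
    proof -
      \<comment> \<open>The C*-identity, used twice, shows that the fourth power of \<open>w\<close>
        is nonzero; hence so is the cube, which lies in \<open>W\<close>.\<close>
      have "w * w \<noteq> 0" using star_mult_self_eq_0[of w] w by simp
      then have "(w * w) * (w * w) \<noteq> 0" using star_mult_self_eq_0[of "w * w"] w by (simp add: star_mult)
      then have "w * w * w \<noteq> 0" by (metis mult.assoc mult_zero_right)
      then show ?thesis using WI[of w] w by auto
    qed
    ultimately have "W = H" using H(2) W_mult by (intro min) (auto simp: \<V>_def W_def)
    then show ?thesis using x by (auto simp: W_def)
  qed
  \<comment> \<open>\<open>star a\<close> has the form w u w with \<open>w = x * star x\<close>, so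
    \<open>a * star a\<close> has the factor \<open>a * x = 0\<close>.\<close>
  have domain: "a = 0" if ax: "a \<in> H" "x \<in> H" "x \<noteq> 0" "a * x = 0" for a x
  proof -
    have "x * star x \<in> H" "x * star x \<noteq> 0" "star (x * star x) = x * star x"
      using ax H' by (simp_all add: star_mult star_star)
    then obtain u where "star a = x * star x * u * (x * star x)"
      using compress[of "x * star x" "star a"] H'(7)[OF ax(1)] by blast
    then have "a * star a = a * x * (star x * u * (x * star x))" by (simp add: mult.assoc)
    then show ?thesis using ax(4) by simp
  qed
  obtain w0 where w0: "w0 \<in> H" "w0 \<noteq> 0" using H(3) H'(2) by blast
  define w where "w = w0 * star w0"
  have w: "w \<in> H" "w \<noteq> 0" "star w = w" using w0 H' by (simp_all add: w_def star_mult star_star)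
  obtain u where u: "u \<in> H" "w = w * u * w" using compress[OF w w(1)] by blast
  \<comment> \<open>\<open>e\<close> is a right unit for \<open>w\<close> alone. Absence of zero
    divisors turns \<open>w * (e * x - x) = 0\<close> into \<open>e * x = x\<close> on all of
    \<open>H\<close>, and taking adjoints then makes \<open>e\<close> self-adjoint.\<close>
  define e where "e = u * w"
  have e: "e \<in> H" using u w H' by (simp add: e_def)
  have we: "w * e = w" using u by (simp add: e_def mult.assoc)
  have ex: "e * x = x" if x: "x \<in> H" for x
  proof (rule ccontr)
    assume "e * x \<noteq> x"
    moreover have "w * (e * x - x) = 0" by (simp add: algebra_simps we flip: mult.assoc)
    ultimately show False using domain[of w "e * x - x"] w x e H' by auto
  qed
  have "e = e * star e"
  proof -
    have "star (e * star e) = star (star e)" using ex[of "star e"] e H' by simp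
    then show ?thesis by (simp add: star_mult star_star)
  qed
  then have "star e = e" using ex[of "star e"] e H' by simp
  have "e \<noteq> 0" using we w by auto
  \<comment> \<open>Left multiplication by \<open>a\<close> has an eigenvector \<open>y\<close> in
    \<open>H\<close>; the difference of \<open>a\<close> and the eigenvalue times \<open>e\<close>
    kills \<open>y\<close>, so it is zero in a domain.\<close>
  have scalar: "\<exists>c. a = c *\<^sub>C e" if a: "a \<in> H" for a
  proof -
    have "finite_dimensional H" using F(2) H(2) by (rule finite_dimensional_subset)
    then obtain y z where y: "y \<in> H" "y \<noteq> 0" "a * y = z *\<^sub>C y"
      by (rule ex_eigenvector[of H a e]) (use a e \<open>e \<noteq> 0\<close> H' in auto)
    have "(a - z *\<^sub>C e) * y = 0" using y ex by (simp add: algebra_simps mult_scaleC_left)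
    then have "a - z *\<^sub>C e = 0" using domain[of "a - z *\<^sub>C e" y] y a e H' by simp
    then show ?thesis by auto
  qed
  have "minimal_projection F e"
    unfolding minimal_projection_def
    using e H(2) \<open>e \<noteq> 0\<close> \<open>star e = e\<close> ex[OF e] her[OF e _ e] scalar by blast
  then show thesis by (rule that)
qed

text \<open>Take an orthogonal family whose two-sided annihilator in \<open>F\<close> is minimal. A
  nonzero annihilator would contain a minimal projection, and adding it to the family would shrink
  the annihilator. A zero annihilator makes the sum a left unit.\<close>

lemma complete_minimal_projections:
  fixes F :: "'a :: cstar_algebra set"
  assumes F: "star_subalgebra F" "finite_dimensional F"
  obtains P where "finite P" "\<And>p. p \<in> P \<Longrightarrow> minimal_projection F p"
    "\<And>p q. p \<in> P \<Longrightarrow> q \<in> P \<Longrightarrow> p \<noteq> q \<Longrightarrow> p * q = 0"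
    "\<And>x. x \<in> F \<Longrightarrow> \<Sum>P * x = x"
proof -
  define Ann where "Ann P = {x\<in>F. \<forall>p\<in>P. p * x = 0 \<and> x * p = 0}" for P
  define orth where "orth P \<longleftrightarrow> finite P \<and> (\<forall>p\<in>P. minimal_projection F p) \<and>
    (\<forall>p\<in>P. \<forall>q\<in>P. p \<noteq> q \<longrightarrow> p * q = 0)" for P
  note F' = star_subalgebraD[OF F(1)]
  have Ann: "star_subalgebra (Ann P)" if "orth P" for P
  proof -
    have sa: "star p = p" if "p \<in> P" for p
      using that \<open>orth P\<close> unfolding orth_def minimal_projection_def by blast
    show ?thesis
    proof (rule star_subalgebraI)
      fix x y assume xy: "x \<in> Ann P" "y \<in> Ann P"
      have "p * (x * y) = 0 \<and> x * y * p = 0" if "p \<in> P" for p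
      proof -
        have "p * (x * y) = p * x * y" "x * y * p = x * (y * p)" by (simp_all only: mult.assoc)
        then show ?thesis using xy that by (simp add: Ann_def)
      qed
      then show "x * y \<in> Ann P" using xy F' by (simp add: Ann_def)
    next
      fix x assume x: "x \<in> Ann P"
      have "p * star x = 0 \<and> star x * p = 0" if "p \<in> P" for p
      proof -
        have "p * star x = star (x * p)" "star x * p = star (p * x)"
          using sa[OF that] by (simp_all add: star_mult)
        then show ?thesis using x that by (simp add: Ann_def)
      qed
      then show "star x \<in> Ann P" using x F' by (auto simp: Ann_def)
    qed (use F' in \<open>auto simp: Ann_def distrib_left distrib_right mult_scaleC_left mult_scaleC_right\<close>)
  qed
  have "orth {}" by (simp add: orth_def)
  then have "Ann ` Collect orth \<noteq> {}" by auto
  then obtain V where V: "V \<in> Ann ` Collect orth"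
    and Vmin: "\<And>W. W \<in> Ann ` Collect orth \<Longrightarrow> W \<subseteq> V \<Longrightarrow> W = V"
    by (rule minimal_subspace[OF F(2)]) (use Ann in \<open>auto simp: star_subalgebra_def Ann_def\<close>)
  then obtain P where P: "orth P" and V_def: "V = Ann P" by blast
  have Ann0: "x = 0" if x: "x \<in> Ann P" for x
  proof (rule ccontr)
    assume "x \<noteq> 0"
    have "finite_dimensional (Ann P)"
      using F(2) by (rule finite_dimensional_subset) (auto simp: Ann_def)
    then obtain p where p: "minimal_projection (Ann P) p"
      using ex_minimal_projection[OF Ann[OF P]] x \<open>x \<noteq> 0\<close> by blast
    then have pA: "p \<in> F" "\<And>q. q \<in> P \<Longrightarrow> q * p = 0 \<and> p * q = 0" "p * p = p" "p \<noteq> 0"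
      by (auto simp: minimal_projection_def Ann_def)
    \<comment> \<open>Minimality in the annihilator passes to \<open>F\<close>, because
      \<open>p * y * p\<close> again annihilates the family.\<close>
    have "\<exists>c. p * y * p = c *\<^sub>C p" if y: "y \<in> F" for y
    proof -
      have "p * y * p * q = 0" "q * (p * y * p) = 0" if "q \<in> P" for q
        using pA(2)[OF that] by (simp_all add: mult.assoc) (simp flip: mult.assoc)
      then have "p * y * p \<in> Ann P" using y pA F' by (auto simp: Ann_def)
      then have "\<exists>c. p * (p * y * p) * p = c *\<^sub>C p" using p by (auto simp: minimal_projection_def)
      then show ?thesis using pA(3) by (metis mult.assoc)
    qed
    then have "minimal_projection F p" using p pA by (auto simp: minimal_projection_def)
    then have "orth (insert p P)" using P pA(2) by (auto simp: orth_def)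
    moreover have "Ann (insert p P) \<subseteq> Ann P" by (auto simp: Ann_def)
    ultimately have "Ann (insert p P) = Ann P" using Vmin[of "Ann (insert p P)"] V_def by blast
    moreover have "p \<in> Ann P" using p by (simp add: minimal_projection_def)
    ultimately have "p * p = 0" by (auto simp: Ann_def)
    then show False using pA by simp
  qed
  have "\<Sum>P * x = x" if x: "x \<in> F" for x
  proof -
    \<comment> \<open>\<open>z\<close> is only known to be killed from the left;
      \<open>z * star z\<close> is killed from both sides and therefore vanishes.\<close>
    define z where "z = x - \<Sum>P * x"
    have pz: "p * z = 0" if p: "p \<in> P" for p
    proof -
      have "p * \<Sum>P = (\<Sum>q\<in>P. if q = p then p else 0)"
        unfolding sum_distrib_left using P p
        by (intro sum.cong) (auto simp: orth_def minimal_projection_def)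
      also have "\<dots> = p" using P p by (simp add: orth_def)
      finally show ?thesis by (simp add: z_def algebra_simps flip: mult.assoc)
    qed
    have "z * star z * p = 0" if p: "p \<in> P" for p
    proof -
      have "star (p * z) = star z * p" using P p by (simp add: star_mult orth_def minimal_projection_def)
      then show ?thesis using pz[OF p] by (simp add: mult.assoc)
    qed
    moreover have "\<Sum>P \<in> F" using P by (intro star_subalgebra_sum[OF F(1)]) (auto simp: orth_def minimal_projection_def)
    ultimately have "z * star z \<in> Ann P"
      using pz x F' by (auto simp: Ann_def z_def simp flip: mult.assoc)
    then have "z = 0" using Ann0 by fastforce
    then show ?thesis by (simp add: z_def)
  qed
  then show thesis using that[of P] P by (auto simp: orth_def)
qed

text \<open>Put \<open>w = p * u * q\<close>. By minimality \<open>star w * w\<close> is a nonzero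
  multiple of \<open>q\<close>, and \<open>p * x * q * star w\<close> is a multiple of
  \<open>p\<close>. Evaluating \<open>p * x * q * star w * w\<close> in both ways exhibits
  \<open>p * x * q\<close> as a multiple of \<open>w\<close>.\<close>

lemma corner_one_dimensional:
  fixes p q :: "'a :: cstar_algebra"
  assumes F: "star_subalgebra F"
    and p: "minimal_projection F p" and q: "minimal_projection F q"
    and u: "u \<in> F" "p * u * q \<noteq> 0" and x: "x \<in> F"
  obtains c where "p * x * q = c *\<^sub>C (p * u * q)"
proof -
  define w where "w = p * u * q"
  note F' = star_subalgebraD[OF F]
  have pq: "p \<in> F" "q \<in> F" "star p = p" "star q = q" "p * p = p" "q * q = q"
    using p q by (auto simp: minimal_projection_def)
  have w: "w \<in> F" "w * q = w" "p * w = w" "star w * w \<noteq> 0"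
    using u pq F' by (auto simp: w_def mult.assoc) (simp add: pq flip: mult.assoc)
  have "q * star w = star w" using arg_cong[OF w(2), of star] pq(4) by (simp add: star_mult)
  moreover have "q * (star w * w) * q = (q * star w) * (w * q)" by (simp only: mult.assoc)
  ultimately have "q * (star w * w) * q = star w * w" using w(2) by simp
  moreover have "star w * w \<in> F" using w(1) F' by simp
  ultimately obtain c where c: "star w * w = c *\<^sub>C q"
    using q unfolding minimal_projection_def by metis
  have "x * q * star w \<in> F" using x pq w F' by simp
  then obtain d where d: "p * (x * q * star w) * p = d *\<^sub>C p"
    using p unfolding minimal_projection_def by blast
  have "star w * p = star w" using arg_cong[OF w(3), of star] pq(3) by (simp add: star_mult)
  then have d': "p * x * q * star w = d *\<^sub>C p" using d by (simp add: mult.assoc)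
  have "c \<noteq> 0" using c w(4) by auto
  have "c *\<^sub>C (p * x * q) = p * x * q * (star w * w)"
    by (simp add: c mult_scaleC_right mult.assoc pq)
  also have "\<dots> = d *\<^sub>C w"
    using w(3) d' by (simp add: mult_scaleC_left flip: mult.assoc)
  finally have "inverse c *\<^sub>C c *\<^sub>C (p * x * q) = inverse c *\<^sub>C d *\<^sub>C w" by simp
  then have "p * x * q = (inverse c * d) *\<^sub>C w"
    using \<open>c \<noteq> 0\<close> by (simp add: scaleC_scaleC scaleC_one)
  then show thesis using that unfolding w_def by blast
qed

text \<open>Lagrange interpolation without constant term. One starts from \<open>h\<close>, not from
  a unit, which \<open>B\<close> may lack; this is where nonzero eigenvalues enter. Multiplying by
  \<open>h\<close> and subtracting \<open>\<mu> q\<close> times the element removes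
  \<open>q\<close>, and distinct eigenvalues keep the coefficient of \<open>p\<close>
  nonzero.\<close>

lemma projection_in_generated:
  fixes \<mu> :: "'a :: cstar_algebra \<Rightarrow> complex"
  assumes B: "star_subalgebra B" and P: "finite P"
    and idem: "\<And>p. p \<in> P \<Longrightarrow> p * p = p"
    and orth: "\<And>p q. p \<in> P \<Longrightarrow> q \<in> P \<Longrightarrow> p \<noteq> q \<Longrightarrow> p * q = 0"
    and \<mu>: "inj_on \<mu> P" "\<And>p. p \<in> P \<Longrightarrow> \<mu> p \<noteq> 0"
    and h: "(\<Sum>p\<in>P. \<mu> p *\<^sub>C p) \<in> B" and p: "p \<in> P"
  shows "p \<in> B"
proof -
  note B' = star_subalgebraD[OF B]
  define h where "h = (\<Sum>p\<in>P. \<mu> p *\<^sub>C p)"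
  have hr: "h * r = \<mu> r *\<^sub>C r" if "r \<in> P" for r
  proof -
    have "h * r = (\<Sum>p\<in>P. if p = r then \<mu> r *\<^sub>C r else 0)"
      unfolding h_def sum_distrib_right using idem orth that
      by (intro sum.cong) (auto simp: mult_scaleC_left)
    then show ?thesis using P that by simp
  qed
  \<comment> \<open>\<open>T\<close> is the set of projections already removed; it finally becomes
    \<open>P - {p}\<close>.\<close>
  have step: "\<exists>\<nu>. \<nu> p \<noteq> 0 \<and> (\<Sum>r\<in>P - T. \<nu> r *\<^sub>C r) \<in> B" if "finite T" "T \<subseteq> P - {p}" for T
    using that
  proof (induction T)
    case empty
    then show ?case using h \<mu>(2)[OF p] by (intro exI[of _ \<mu>]) simp
  next
    case (insert q T)
    then obtain \<nu> where \<nu>: "\<nu> p \<noteq> 0" "(\<Sum>r\<in>P - T. \<nu> r *\<^sub>C r) \<in> B" by auto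
    define z where "z = (\<Sum>r\<in>P - T. \<nu> r *\<^sub>C r)"
    have "h * z = (\<Sum>r\<in>P - T. (\<mu> r * \<nu> r) *\<^sub>C r)"
      unfolding z_def sum_distrib_left
      by (intro sum.cong) (simp_all add: mult_scaleC_right hr scaleC_scaleC mult.commute)
    moreover have "\<mu> q *\<^sub>C z = (\<Sum>r\<in>P - T. (\<mu> q * \<nu> r) *\<^sub>C r)"
      by (simp add: z_def scaleC_sum_right scaleC_scaleC)
    ultimately have "h * z - \<mu> q *\<^sub>C z = (\<Sum>r\<in>P - T. ((\<mu> r - \<mu> q) * \<nu> r) *\<^sub>C r)"
      by (simp add: left_diff_distrib scaleC_diff_left sum_subtractf)
    also have "\<dots> = (\<Sum>r\<in>P - insert q T. ((\<mu> r - \<mu> q) * \<nu> r) *\<^sub>C r)"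
      using P by (intro sum.mono_neutral_right) auto
    finally have "h * z - \<mu> q *\<^sub>C z =
        (\<Sum>r\<in>P - insert q T. ((\<mu> r - \<mu> q) * \<nu> r) *\<^sub>C r)" .
    moreover have "h * z - \<mu> q *\<^sub>C z \<in> B"
      unfolding h_def z_def by (intro B' h \<nu>(2))
    ultimately have "(\<Sum>r\<in>P - insert q T. ((\<mu> r - \<mu> q) * \<nu> r) *\<^sub>C r) \<in> B" by simp
    moreover have "\<mu> p \<noteq> \<mu> q" using \<mu>(1) p insert.prems by (auto simp: inj_on_def)
    ultimately show ?case using \<nu>(1) by (intro exI[of _ "\<lambda>r. (\<mu> r - \<mu> q) * \<nu> r"]) simp
  qed
  obtain \<nu> where \<nu>: "\<nu> p \<noteq> 0" "(\<Sum>r\<in>P - (P - {p}). \<nu> r *\<^sub>C r) \<in> B"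
    using step[of "P - {p}"] P by auto
  have "P - (P - {p}) = {p}" using p by auto
  then have "\<nu> p *\<^sub>C p \<in> B" using \<nu>(2) by simp
  then have "inverse (\<nu> p) *\<^sub>C \<nu> p *\<^sub>C p \<in> B" by (rule B')
  then show ?thesis using \<nu>(1) by (simp add: scaleC_scaleC scaleC_one)
qed

section \<open>Perturbation into general position\<close>

lemma perturb_inj:
  fixes l :: "'b \<Rightarrow> real"
  assumes "finite P" "\<delta> > 0"
  obtains m where "inj_on m P" "\<And>p. p \<in> P \<Longrightarrow> m p \<noteq> 0" "\<And>p. p \<in> P \<Longrightarrow> \<bar>m p - l p\<bar> < \<delta>"
proof -
  have "\<exists>m. inj_on m P \<and> (\<forall>p\<in>P. m p \<noteq> 0 \<and> \<bar>m p - l p\<bar> < \<delta>)"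
    using assms(1)
  proof (induction P)
    case (insert q P)
    then obtain m where m: "inj_on m P" "\<forall>p\<in>P. m p \<noteq> 0 \<and> \<bar>m p - l p\<bar> < \<delta>" by blast
    have "infinite ({l q - \<delta><..<l q + \<delta>} - insert 0 (m ` P))"
      using assms(2) insert.hyps by (intro Diff_infinite_finite) (auto simp: infinite_Ioo)
    then obtain t where t: "t \<in> {l q - \<delta><..<l q + \<delta>}" "t \<noteq> 0" "t \<notin> m ` P"
      by (metis Diff_iff ex_in_conv finite.emptyI insert_iff)
    have "inj_on (m(q := t)) (insert q P)"
      using m(1) t(3) insert.hyps by (auto simp: inj_on_def)
    moreover have "\<forall>p\<in>insert q P. (m(q := t)) p \<noteq> 0 \<and> \<bar>(m(q := t)) p - l p\<bar> < \<delta>"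
      using m(2) t by auto
    ultimately show ?case by blast
  qed simp
  then show thesis using that by blast
qed

text \<open>Corners of \<open>k + t *\<^sub>R w\<close> are affine in \<open>t\<close>, so each of
  them excludes only finitely many parameters.\<close>

lemma finite_roots_affine:
  fixes u v :: "'a :: real_vector"
  assumes "u \<noteq> 0 \<or> v \<noteq> 0"
  shows "finite {t :: real. u + t *\<^sub>R v = 0}"
proof -
  have unique: "s = t" if "u + s *\<^sub>R v = 0" "u + t *\<^sub>R v = 0" for s t
  proof -
    have "(s - t) *\<^sub>R v = 0" using that by (metis add_left_cancel eq_iff_diff_eq_0 scaleR_left_diff_distrib)
    then show ?thesis using that assms by auto
  qed
  show ?thesis
  proof (cases "\<exists>s. u + s *\<^sub>R v = 0")
    case True
    then obtain s where "u + s *\<^sub>R v = 0" by blast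
    then have "{t. u + t *\<^sub>R v = 0} \<subseteq> {s}" using unique by blast
    then show ?thesis by (rule finite_subset) simp
  qed simp
qed

lemma scaleR_in_star_subalgebra: "star_subalgebra B \<Longrightarrow> x \<in> B \<Longrightarrow> r *\<^sub>R x \<in> B"
  by (simp add: scaleR_scaleC star_subalgebraD)

lemma star_scaleR: "star (r *\<^sub>R x :: 'a :: cstar_algebra) = r *\<^sub>R star x"
  by (simp add: scaleR_scaleC star_scaleC)

text \<open>The pairs are treated one after another. A small self-adjoint term makes the new corner
  nonzero, and avoiding finitely many sizes of that term keeps the earlier corners nonzero.\<close>

lemma perturb_corners:
  fixes k0 :: "'a :: cstar_algebra"
  assumes F: "star_subalgebra F" and T: "finite T" and \<delta>: "\<delta> > 0" and k0: "k0 \<in> F" "star k0 = k0"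
    and proj: "\<And>p q. (p, q) \<in> T \<Longrightarrow> p \<in> F \<and> q \<in> F \<and> star p = p \<and> star q = q \<and>
      p * p = p \<and> q * q = q \<and> p * q = 0"
  obtains k where "k \<in> F" "star k = k" "norm (k - k0) < \<delta>"
    "\<And>p q x. (p, q) \<in> T \<Longrightarrow> x \<in> F \<Longrightarrow> p * x * q \<noteq> 0 \<Longrightarrow> p * k * q \<noteq> 0"
proof -
  note F' = star_subalgebraD[OF F]
  have "\<exists>k\<in>F. star k = k \<and> norm (k - k0) < \<delta> \<and>
      (\<forall>p q x. (p, q) \<in> T \<longrightarrow> x \<in> F \<longrightarrow> p * x * q \<noteq> 0 \<longrightarrow> p * k * q \<noteq> 0)"
    using T \<delta> proj
  proof (induction T arbitrary: \<delta>)
    case empty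
    then show ?case using k0 by auto
  next
    case (insert pq T)
    obtain p q where [simp]: "pq = (p, q)" by (cases pq)
    have "\<exists>k\<in>F. star k = k \<and> norm (k - k0) < \<delta> / 2 \<and>
        (\<forall>p q x. (p, q) \<in> T \<longrightarrow> x \<in> F \<longrightarrow> p * x * q \<noteq> 0 \<longrightarrow> p * k * q \<noteq> 0)"
      using insert.prems by (intro insert.IH) auto
    then obtain k where k: "k \<in> F" "star k = k" "norm (k - k0) < \<delta> / 2"
      and kT: "\<And>p q x. (p, q) \<in> T \<Longrightarrow> x \<in> F \<Longrightarrow> p * x * q \<noteq> 0 \<Longrightarrow> p * k * q \<noteq> 0"
      by blast
    show ?case
    proof (cases "\<exists>x\<in>F. p * x * q \<noteq> 0")
      case False
      then show ?thesis using k kT insert.prems(1) by (intro bexI[of _ k]) auto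
    next
      case True
      then obtain x where x: "x \<in> F" "p * x * q \<noteq> 0" by blast
      have pq: "p \<in> F" "q \<in> F" "star p = p" "star q = q" "p * p = p" "q * q = q" "p * q = 0"
        using insert.prems(2)[of p q] by auto
      \<comment> \<open>Adding the adjoint makes \<open>w\<close> self-adjoint; since
        \<open>p * q = 0\<close>, the added summand does not contribute to the corner
        \<open>p * w * q\<close>.\<close>
      define w where "w = p * x * q + star (p * x * q)"
      have "p * w * q = (p * p) * x * (q * q) + (p * q) * star x * (p * q)"
        by (simp add: w_def star_mult pq(3,4) algebra_simps)
      then have pwq: "p * w * q \<noteq> 0" using x pq by simp
      have w: "w \<in> F" "star w = w" using x pq F' by (auto simp: w_def star_add star_star add.commute)
      \<comment> \<open>Only corners that are nonzero somewhere on \<open>F\<close> matter. For each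
        of them \<open>k\<close> (old pairs) or \<open>w\<close> (new pair) has a nonzero corner, so
        \<open>bad\<close> is finite.\<close>
      define N where "N = {(p', q') \<in> insert pq T. \<exists>x\<in>F. p' * x * q' \<noteq> 0}"
      define bad where "bad = (\<Union>(p', q')\<in>N. {t :: real. p' * k * q' + t *\<^sub>R (p' * w * q') = 0})"
      have "N \<subseteq> insert pq T" by (auto simp: N_def)
      then have "finite N" by (rule finite_subset) (simp add: insert.hyps(1))
      have "finite bad"
        unfolding bad_def
      proof (rule finite_UN_I[OF \<open>finite N\<close>])
        fix s assume "s \<in> N"
        then show "finite (case s of (p', q') \<Rightarrow> {t :: real. p' * k * q' + t *\<^sub>R (p' * w * q') = 0})"
          using pwq kT by (auto simp: N_def split: prod.split intro!: finite_roots_affine)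
      qed
      \<comment> \<open>With \<open>t < \<eta>\<close> the new term has norm at most
        \<open>\<delta> / 2\<close>; the other half was spent on \<open>k\<close>.\<close>
      define \<eta> where "\<eta> = \<delta> / (2 * (1 + norm w))"
      have \<eta>: "\<eta> > 0" using insert.prems(1) by (simp add: \<eta>_def add_pos_nonneg)
      then have "infinite ({0<..<\<eta>} - bad)"
        using \<open>finite bad\<close> by (intro Diff_infinite_finite) (auto simp: infinite_Ioo)
      then obtain t where t: "0 < t" "t < \<eta>" "t \<notin> bad"
        by (metis DiffD1 DiffD2 ex_in_conv finite.emptyI greaterThanLessThan_iff)
      have "norm (t *\<^sub>R w) \<le> \<eta> * (1 + norm w)"
        using t by (auto intro!: mult_mono)
      also have "\<dots> = \<delta> / 2" using add_pos_nonneg[of 1 "norm w"] by (simp add: \<eta>_def field_simps)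
      finally have "norm (k + t *\<^sub>R w - k0) < \<delta>"
        using k(3) norm_triangle_ineq[of "k - k0" "t *\<^sub>R w"] by (simp add: algebra_simps)
      moreover have "k + t *\<^sub>R w \<in> F" "star (k + t *\<^sub>R w) = k + t *\<^sub>R w"
        using k w F' scaleR_in_star_subalgebra[OF F] by (auto simp: star_add star_scaleR)
      moreover have "p' * (k + t *\<^sub>R w) * q' \<noteq> 0"
        if "(p', q') \<in> insert pq T" "y \<in> F" "p' * y * q' \<noteq> 0" for p' q' y
      proof -
        have "(p', q') \<in> N" using that by (auto simp: N_def)
        then show ?thesis using t(3) by (auto simp: bad_def algebra_simps)
      qed
      ultimately show ?thesis by blast
    qed
  qed
  then show thesis using that by blast
qed

lemma real_imaginary_parts:
  fixes a :: "'a :: cstar_algebra"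
  obtains h k where "a = h + \<i> *\<^sub>C k" "star h = h" "star k = k"
proof -
  define h where "h = (1 / 2) *\<^sub>C (a + star a)"
  define k where "k = (- \<i> / 2) *\<^sub>C (a - star a)"
  have "h + \<i> *\<^sub>C k = (1 / 2) *\<^sub>C a + (1 / 2) *\<^sub>C a"
    by (simp add: h_def k_def scaleC_scaleC scaleC_add_right scaleC_diff_right)
  also have "\<dots> = a" by (simp add: scaleC_one flip: scaleC_add_left)
  finally have "a = h + \<i> *\<^sub>C k" ..
  moreover have "star h = h"
    by (simp add: h_def star_scaleC star_add star_star add.commute)
  moreover have "star k = k"
  proof -
    have "star k = (\<i> / 2) *\<^sub>C (star a - a)" by (simp add: k_def star_scaleC star_diff star_star star_minus
          complex_vector.scale_minus_left)
    also have "\<dots> = k" by (simp add: k_def scaleC_diff_right complex_vector.scale_minus_left)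
    finally show ?thesis .
  qed
  ultimately show thesis by (rule that)
qed

text \<open>This lets a single generator do the work of two self-adjoint ones.\<close>

lemma self_adjoint_parts_in:
  assumes B: "star_subalgebra B" and b: "h + \<i> *\<^sub>C k \<in> B" "star h = h" "star k = k"
  shows "h \<in> B" "k \<in> B"
proof -
  note B' = star_subalgebraD[OF B]
  have s: "star (h + \<i> *\<^sub>C k) = h - \<i> *\<^sub>C k"
    using b by (simp add: star_add star_scaleC complex_vector.scale_minus_left)
  have "(1 / 2) *\<^sub>C ((h + \<i> *\<^sub>C k) + star (h + \<i> *\<^sub>C k)) = h"
    by (simp only: s) (simp add: scaleC_add_right scaleC_one flip: scaleC_add_left)
  then show "h \<in> B" using B'(5)[OF B'(3)[OF b(1) B'(7)[OF b(1)]]] by metis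
  have "(- \<i> / 2) *\<^sub>C ((h + \<i> *\<^sub>C k) - star (h + \<i> *\<^sub>C k)) = (1 / 2) *\<^sub>C k + (1 / 2) *\<^sub>C k"
    by (simp only: s) (simp add: scaleC_add_right scaleC_scaleC)
  also have "\<dots> = k" by (simp add: scaleC_one flip: scaleC_add_left)
  finally show "k \<in> B" using B'(5)[OF B'(4)[OF b(1) B'(7)[OF b(1)]]] by metis
qed

text \<open>
  The projections are taken minimal in the commutant \<open>D\<close> of the real part \<open>h0\<close>, so that they
  diagonalise \<open>h0\<close>. They stay minimal in \<open>F\<close>, because every \<open>p * x * p\<close> commutes with \<open>h0\<close>.
\<close>

lemma finite_dimensional_dense_generators:
  fixes F :: "'a :: cstar_algebra set"
  assumes F: "star_subalgebra F" "finite_dimensional F" and a: "a \<in> F" and \<epsilon>: "\<epsilon> > 0"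
  obtains b where "b \<in> F" "norm (b - a) < \<epsilon>" "\<And>B. star_subalgebra B \<Longrightarrow> b \<in> B \<Longrightarrow> F \<subseteq> B"
proof -
  note F' = star_subalgebraD[OF F(1)]
  obtain h0 k0 where hk: "a = h0 + \<i> *\<^sub>C k0" "star h0 = h0" "star k0 = k0"
    using real_imaginary_parts .
  then have hkF: "h0 \<in> F" "k0 \<in> F" using self_adjoint_parts_in[OF F(1), of h0 k0] a by simp_all
  define D where "D = {x\<in>F. x * h0 = h0 * x}"
  have D: "star_subalgebra D"
  proof (rule star_subalgebraI)
    fix x y assume xy: "x \<in> D" "y \<in> D"
    have "x * y * h0 = x * (y * h0)" by (rule mult.assoc)
    also have "\<dots> = x * (h0 * y)" using xy by (simp add: D_def)
    also have "\<dots> = x * h0 * y" by (rule mult.assoc[symmetric])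
    also have "\<dots> = h0 * x * y" using xy by (simp add: D_def)
    also have "\<dots> = h0 * (x * y)" by (rule mult.assoc)
    finally show "x * y \<in> D" using xy F' by (simp add: D_def)
  next
    fix x assume x: "x \<in> D"
    have "star (x * h0) = star (h0 * x)" using x by (simp add: D_def)
    then show "star x \<in> D" using x F' hk(2) by (simp add: D_def star_mult)
  qed (use F' in \<open>auto simp: D_def algebra_simps mult_scaleC_left mult_scaleC_right\<close>)
  have "finite_dimensional D" by (rule finite_dimensional_subset[OF F(2)]) (auto simp: D_def)
  then obtain P where P: "finite P" "\<And>p. p \<in> P \<Longrightarrow> minimal_projection D p"
    and orth: "\<And>p q. p \<in> P \<Longrightarrow> q \<in> P \<Longrightarrow> p \<noteq> q \<Longrightarrow> p * q = 0"
    and unit: "\<And>x. x \<in> D \<Longrightarrow> \<Sum>P * x = x"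
    using complete_minimal_projections[OF D] by metis
  have proj: "p \<in> F" "star p = p" "p * p = p" "p \<noteq> 0" "p * h0 = h0 * p" if "p \<in> P" for p
    using P(2)[OF that] by (auto simp: minimal_projection_def D_def)
  have h0D: "h0 \<in> D" using hkF by (simp add: D_def)
  \<comment> \<open>Since \<open>p\<close> commutes with \<open>h0\<close>, minimality makes
    \<open>h0 * p = p * h0 * p\<close> a multiple of \<open>p\<close>; self-adjointness makes the
    factor real.\<close>
  have eig: "\<exists>l :: real. h0 * p = l *\<^sub>R p" if p: "p \<in> P" for p
  proof -
    obtain c where c: "p * h0 * p = c *\<^sub>C p"
      using P(2)[OF p] h0D by (auto simp: minimal_projection_def)
    then have h0p: "h0 * p = c *\<^sub>C p" using proj[OF p] by (metis mult.assoc)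
    have "star (p * h0 * p) = p * h0 * p"
      using proj[OF p] hk by (simp add: star_mult mult.assoc)
    then have "(cnj c - c) *\<^sub>C p = 0" using c proj[OF p] by (simp add: star_scaleC scaleC_diff_left)
    then have "cnj c = c" using proj[OF p] by (simp add: scaleC_eq_0_iff)
    then have "c = complex_of_real (Re c)" by (metis Reals_cnj_iff of_real_Re)
    then show ?thesis using h0p by (metis scaleR_scaleC)
  qed
  then obtain l :: "'a \<Rightarrow> real" where l: "\<And>p. p \<in> P \<Longrightarrow> h0 * p = l p *\<^sub>R p" by metis
  have minF: "minimal_projection F p" if p: "p \<in> P" for p
  proof -
    have "\<exists>c. p * x * p = c *\<^sub>C p" if x: "x \<in> F" for x
    proof -
      \<comment> \<open>On either side of \<open>p * x * p\<close>, \<open>h0\<close> acts as the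
        same scalar \<open>l p\<close>.\<close>
      have "p * x * p * h0 = p * x * (h0 * p)" using proj[OF p] by (simp add: mult.assoc)
      also have "\<dots> = h0 * p * x * p" using l[OF p] by simp
      finally have "p * x * p \<in> D" using x proj[OF p] F' by (simp add: D_def mult.assoc)
      then obtain c where "p * (p * x * p) * p = c *\<^sub>C p"
        using P(2)[OF p] by (auto simp: minimal_projection_def)
      then show ?thesis using proj[OF p] by (metis mult.assoc)
    qed
    then show ?thesis using proj[OF p] by (simp add: minimal_projection_def)
  qed
  define e where "e = \<Sum>P"
  have eD: "e \<in> D"
    unfolding e_def using P(2) by (intro star_subalgebra_sum[OF D]) (auto simp: minimal_projection_def)
  have star_e: "star e = e" using proj by (simp add: e_def star_sum)
  have unitF: "e * x = x" if x: "x \<in> F" for x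
  proof -
    \<comment> \<open>So far \<open>e\<close> is a unit for \<open>D\<close> only. As
      \<open>h0\<close> kills \<open>z\<close>, the element \<open>z * star z\<close> commutes with
      \<open>h0\<close> and lies in \<open>D\<close>, where \<open>e\<close> fixes it; but
      \<open>e * z = 0\<close>.\<close>
    define z where "z = x - e * x"
    have "h0 * e = h0" using eD unit[OF h0D] by (simp add: D_def e_def)
    then have h0z: "h0 * z = 0" by (simp add: z_def algebra_simps flip: mult.assoc)
    have "star z * h0 = star (h0 * z)" using hk by (simp add: star_mult)
    then have zh0: "star z * h0 = 0" by (simp add: h0z)
    have "z \<in> F" using x eD F' by (simp add: z_def D_def)
    moreover have "z * star z * h0 = 0" by (simp add: zh0 mult.assoc)
    moreover have "h0 * (z * star z) = 0" by (simp add: h0z flip: mult.assoc)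
    ultimately have "z * star z \<in> D" using F' by (simp add: D_def)
    then have "z * star z = e * z * star z" using unit by (simp add: e_def mult.assoc)
    moreover have "e * z = 0"
      using unit[OF eD] by (simp add: z_def e_def algebra_simps flip: mult.assoc)
    ultimately have "z = 0" by simp
    then show ?thesis by (simp add: z_def)
  qed
  have h0_sum: "h0 = (\<Sum>p\<in>P. l p *\<^sub>R p)"
    using eD unit[OF h0D] l by (simp add: D_def e_def sum_distrib_left)
  \<comment> \<open>Moving every eigenvalue by less than \<open>\<delta>\<close> moves
    \<open>h0\<close> by at most \<open>\<epsilon> / 2\<close>. The summand 1 guards against an
    empty \<open>P\<close>.\<close>
  define \<delta> where "\<delta> = \<epsilon> / (2 * (1 + (\<Sum>p\<in>P. norm p)))"
  have S: "1 + (\<Sum>p\<in>P. norm p) > 0" by (intro add_pos_nonneg sum_nonneg) auto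
  then have "\<delta> > 0" using \<epsilon> by (simp add: \<delta>_def)
  then obtain m where m: "inj_on m P" "\<And>p. p \<in> P \<Longrightarrow> m p \<noteq> 0" "\<And>p. p \<in> P \<Longrightarrow> \<bar>m p - l p\<bar> < \<delta>"
    using perturb_inj[OF P(1)] by metis
  define h where "h = (\<Sum>p\<in>P. m p *\<^sub>R p)"
  have h: "h \<in> F" "star h = h"
    using proj scaleR_in_star_subalgebra[OF F(1)]
    by (auto simp: h_def star_sum star_scaleR intro!: star_subalgebra_sum[OF F(1)])
  have "norm (h - h0) \<le> (\<Sum>p\<in>P. \<delta> * norm p)"
    unfolding h_def h0_sum sum_subtractf[symmetric] scaleR_left_diff_distrib[symmetric]
    using m(3) by (intro sum_norm_le) (auto intro!: mult_right_mono simp: less_imp_le)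
  also have "\<dots> = \<delta> * (\<Sum>p\<in>P. norm p)" by (rule sum_distrib_left[symmetric])
  also have "\<dots> \<le> \<epsilon> / 2" using S \<epsilon> by (simp add: \<delta>_def field_simps)
  finally have hh0: "norm (h - h0) \<le> \<epsilon> / 2" .
  \<comment> \<open>Off-diagonal pairs only: these are orthogonal, as \<open>perturb_corners\<close>
    requires, and diagonal corners are scalar by minimality.\<close>
  define T where "T = {(p, q). p \<in> P \<and> q \<in> P \<and> p \<noteq> q}"
  have "T \<subseteq> P \<times> P" by (auto simp: T_def)
  then have "finite T" by (rule finite_subset) (simp add: P(1))
  then obtain k where k: "k \<in> F" "star k = k" "norm (k - k0) < \<epsilon> / 2"
    and kT: "\<And>p q x. (p, q) \<in> T \<Longrightarrow> x \<in> F \<Longrightarrow> p * x * q \<noteq> 0 \<Longrightarrow> p * k * q \<noteq> 0"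
    by (rule perturb_corners[OF F(1) _ _ hkF(2) hk(3), of T "\<epsilon> / 2"])
      (use \<epsilon> proj orth in \<open>auto simp: T_def\<close>)
  show thesis
  proof
    show "h + \<i> *\<^sub>C k \<in> F" using h k F' by simp
    have "norm (h + \<i> *\<^sub>C k - a) = norm ((h - h0) + \<i> *\<^sub>C (k - k0))"
      by (simp add: hk(1) scaleC_diff_right algebra_simps)
    also have "\<dots> \<le> norm (h - h0) + norm (k - k0)"
      using norm_triangle_ineq[of "h - h0" "\<i> *\<^sub>C (k - k0)"] by (simp add: norm_scaleC)
    also have "\<dots> < \<epsilon>" using hh0 k(3) by simp
    finally show "norm (h + \<i> *\<^sub>C k - a) < \<epsilon>" .
  next
    \<comment> \<open>\<open>B\<close> need not be closed: \<open>F\<close> is generated by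
      algebraic operations alone.\<close>
    fix B assume B: "star_subalgebra B" and hkB: "h + \<i> *\<^sub>C k \<in> B"
    note B' = star_subalgebraD[OF B]
    have hB: "h \<in> B" and kB: "k \<in> B" using self_adjoint_parts_in[OF B hkB] h k by auto
    have pB: "p \<in> B" if "p \<in> P" for p
      by (rule projection_in_generated[OF B P(1) _ orth, of "\<lambda>p. complex_of_real (m p)"])
        (use m(1,2) proj hB that in \<open>auto simp: h_def inj_on_def scaleR_scaleC\<close>)
    have corner: "p * x * q \<in> B" if pq: "p \<in> P" "q \<in> P" and x: "x \<in> F" for p q x
    proof (cases "p = q")
      case True
      then obtain c where "p * x * q = c *\<^sub>C p" using minF[OF pq(1)] x by (auto simp: minimal_projection_def)
      then show ?thesis using pB[OF pq(1)] B' by simp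
    next
      case False
      show ?thesis
      proof (cases "p * x * q = 0")
        case nz: False
        have "p * k * q \<noteq> 0" using kT[OF _ x nz] False pq by (simp add: T_def)
        then obtain c where "p * x * q = c *\<^sub>C (p * k * q)"
          using corner_one_dimensional[OF F(1) minF[OF pq(1)] minF[OF pq(2)] k(1) _ x] by blast
        then show ?thesis using pB pq kB B' by simp
      qed (use B' in simp)
    qed
    show "F \<subseteq> B"
    proof
      fix x assume x: "x \<in> F"
      \<comment> \<open>By taking adjoints \<open>e\<close> is a right unit too, so \<open>x\<close>
        is the sum of its corners \<open>p * x * q\<close>.\<close>
      have "x * e = star (e * star x)" using star_e by (simp add: star_mult star_star)
      then have "x * e = x" using unitF[of "star x"] x F' by (simp add: star_star)
      then have "x = e * x * e" using unitF[OF x] by simp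
      also have "\<dots> = (\<Sum>p\<in>P. p * x * e)" by (simp only: e_def sum_distrib_right)
      also have "\<dots> = (\<Sum>p\<in>P. \<Sum>q\<in>P. p * x * q)" by (simp only: e_def sum_distrib_left)
      also have "\<dots> \<in> B" using corner x by (intro star_subalgebra_sum[OF B]) auto
      finally show "x \<in> B" .
    qed
  qed
qed

section \<open>Singly generated subalgebras\<close>

lemma bounded_linear_star: "bounded_linear (star :: 'a :: cstar_algebra \<Rightarrow> 'a)"
  by (rule bounded_linear_intro[where K = 1]) (simp_all add: star_add star_scaleR)

lemma star_subalgebra_closure:
  assumes B: "star_subalgebra B"
  shows "star_subalgebra (closure B)"
proof (rule star_subalgebraI)
  note B' = star_subalgebraD[OF B]
  show "0 \<in> closure B" using B'(2) closure_subset by blast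
next
  fix x y assume "x \<in> closure B" "y \<in> closure B"
  then obtain f g where f: "\<And>n. f n \<in> B" "f \<longlonglongrightarrow> x" and g: "\<And>n. g n \<in> B" "g \<longlonglongrightarrow> y"
    unfolding closure_sequential by blast
  show "x + y \<in> closure B" unfolding closure_sequential
    by (rule exI[of _ "\<lambda>n. f n + g n"])
      (use f g star_subalgebraD[OF B] in \<open>auto intro: tendsto_intros\<close>)
  show "x * y \<in> closure B" unfolding closure_sequential
    by (rule exI[of _ "\<lambda>n. f n * g n"])
      (use f g star_subalgebraD[OF B] in \<open>auto intro: tendsto_intros\<close>)
next
  fix c x assume "x \<in> closure B"
  then obtain f where f: "\<And>n. f n \<in> B" "f \<longlonglongrightarrow> x" unfolding closure_sequential by blast
  show "c *\<^sub>C x \<in> closure B" unfolding closure_sequential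
    by (rule exI[of _ "\<lambda>n. c *\<^sub>C f n"])
      (use f star_subalgebraD[OF B] in \<open>auto intro: bounded_linear.tendsto[OF bounded_linear_scaleC]\<close>)
  show "star x \<in> closure B" unfolding closure_sequential
    by (rule exI[of _ "\<lambda>n. star (f n)"])
      (use f star_subalgebraD[OF B] in \<open>auto intro: bounded_linear.tendsto[OF bounded_linear_star]\<close>)
qed

lemma cstar_generated_subalgebra: "cstar_subalgebra (cstar_generated S)"
  unfolding cstar_generated_def
proof (rule hull_in)
  fix T :: "'a set set" assume T: "Ball T cstar_subalgebra"
  then have "closed (\<Inter>T)" by (intro closed_Inter) (auto simp: cstar_subalgebra_def)
  moreover have "star_subalgebra (\<Inter>T)"
    using T by (intro star_subalgebraI) (auto simp: cstar_subalgebra_iff star_subalgebraD)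
  ultimately show "cstar_subalgebra (\<Inter>T)" by (simp add: cstar_subalgebra_iff)
qed

lemma cstar_generated_superset: "S \<subseteq> cstar_generated S"
  unfolding cstar_generated_def by (rule hull_subset)

lemma cstar_generated_minimal:
  "S \<subseteq> B \<Longrightarrow> cstar_subalgebra B \<Longrightarrow> cstar_generated S \<subseteq> B"
  unfolding cstar_generated_def by (rule hull_minimal)

text \<open>Noncommutative polynomials in x and its adjoint without constant term, as functions.
  Keeping the function rather than its value allows the same polynomial to be evaluated at nearby
  elements.\<close>

inductive_set star_polynomials :: "('a :: cstar_algebra \<Rightarrow> 'a) set" where
  ident: "(\<lambda>x. x) \<in> star_polynomials"
| add: "f \<in> star_polynomials \<Longrightarrow> g \<in> star_polynomials \<Longrightarrow> (\<lambda>x. f x + g x) \<in> star_polynomials"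
| scale: "f \<in> star_polynomials \<Longrightarrow> (\<lambda>x. c *\<^sub>C f x) \<in> star_polynomials"
| mult: "f \<in> star_polynomials \<Longrightarrow> g \<in> star_polynomials \<Longrightarrow> (\<lambda>x. f x * g x) \<in> star_polynomials"
| star: "f \<in> star_polynomials \<Longrightarrow> (\<lambda>x. star (f x)) \<in> star_polynomials"

lemma continuous_star_polynomial: "f \<in> star_polynomials \<Longrightarrow> continuous_on UNIV f"
  by (induction rule: star_polynomials.induct)
    (auto intro: continuous_intros bounded_linear.continuous_on[OF bounded_linear_scaleC]
      bounded_linear.continuous_on[OF bounded_linear_star])

lemma star_polynomial_in_subalgebra:
  "f \<in> star_polynomials \<Longrightarrow> star_subalgebra B \<Longrightarrow> a \<in> B \<Longrightarrow> f a \<in> B"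
  by (induction rule: star_polynomials.induct) (simp_all add: star_subalgebraD)

lemma cstar_generated_singleton: "cstar_generated {a} = closure ((\<lambda>f. f a) ` star_polynomials)"
proof
  let ?B = "(\<lambda>f. f a) ` star_polynomials"
  have "star_subalgebra ?B"
  proof (rule star_subalgebraI)
    show "0 \<in> ?B"
      using star_polynomials.scale[OF star_polynomials.ident, of 0] by (force simp: image_iff)
  qed (auto simp: image_iff intro: star_polynomials.intros)
  then have "cstar_subalgebra (closure ?B)"
    by (simp add: cstar_subalgebra_iff star_subalgebra_closure)
  moreover have "a \<in> closure ?B"
    using closure_subset[of ?B] star_polynomials.ident by (force simp: image_iff)
  ultimately show "cstar_generated {a} \<subseteq> closure ?B"
    by (intro cstar_generated_minimal) auto
  have "?B \<subseteq> cstar_generated {a}"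
    using star_polynomial_in_subalgebra cstar_generated_subalgebra[of "{a}"]
      cstar_generated_superset[of "{a}"] by (auto simp: cstar_subalgebra_iff)
  then show "closure ?B \<subseteq> cstar_generated {a}"
    using cstar_generated_subalgebra[of "{a}"] by (simp add: closure_minimal cstar_subalgebra_iff)
qed

definition generates_near :: "'a :: cstar_algebra \<Rightarrow> real \<Rightarrow> 'a set" where
  "generates_near c \<epsilon> = {a. \<exists>g\<in>cstar_generated {a}. norm (c - g) < \<epsilon>}"

text \<open>An open ball meets the closure of the polynomial values at \<open>a\<close> only if it
  contains one such value \<open>f a\<close>, and by continuity \<open>f\<close> stays in the ball
  near \<open>a\<close>.\<close>

lemma open_generates_near: "open (generates_near c \<epsilon>)"
proof -
  have "generates_near c \<epsilon> = (\<Union>f\<in>star_polynomials. f -` ball c \<epsilon>)" (is "?L = ?R")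
  proof
    show "?R \<subseteq> ?L"
    proof
      fix a assume "a \<in> ?R"
      then obtain f where "f \<in> star_polynomials" "norm (c - f a) < \<epsilon>" by (auto simp: dist_norm)
      moreover from this(1) have "f a \<in> cstar_generated {a}"
        unfolding cstar_generated_singleton
        by (intro subsetD[OF closure_subset] image_eqI[where x = f]) simp_all
      ultimately show "a \<in> ?L" by (auto simp: generates_near_def)
    qed
    show "?L \<subseteq> ?R"
    proof
      fix a assume "a \<in> ?L"
      then obtain g where "g \<in> closure ((\<lambda>f. f a) ` star_polynomials)" "g \<in> ball c \<epsilon>"
        by (auto simp: generates_near_def cstar_generated_singleton dist_norm)
      then have "ball c \<epsilon> \<inter> (\<lambda>f. f a) ` star_polynomials \<noteq> {}"
        using open_Int_closure_eq_empty[of "ball c \<epsilon>"] by blast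
      then show "a \<in> ?R" by auto
    qed
  qed
  also have "open \<dots>"
    using continuous_star_polynomial by (intro open_UN ballI open_vimage) auto
  finally show ?thesis .
qed

section \<open>Local approximation by finite-dimensional subalgebras\<close>

text \<open>Two elements suffice: \<open>a\<close> is to be perturbed into a generator,
  \<open>c\<close> is to be reached by it. Unlike an inductive system, this form passes easily to
  the unitization.\<close>

definition locally_finite_dimensional :: "'a :: cstar_algebra itself \<Rightarrow> bool" where
  "locally_finite_dimensional _ \<longleftrightarrow> (\<forall>(a :: 'a) c. \<forall>\<epsilon>>0. \<exists>F. star_subalgebra F \<and>
     finite_dimensional F \<and> (\<exists>a'\<in>F. norm (a' - a) < \<epsilon>) \<and> (\<exists>c'\<in>F. norm (c' - c) < \<epsilon>))"

text \<open>Move \<open>a\<close> and \<open>c\<close> into a common finite-dimensional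
  \<open>F\<close>, then perturb the first inside \<open>F\<close> to a generator of
  \<open>F\<close>; it generates the approximant of \<open>c\<close>.\<close>

lemma dense_generates_near:
  fixes a c :: "'a :: cstar_algebra"
  assumes "locally_finite_dimensional TYPE('a)" "\<epsilon> > 0" "\<delta> > 0"
  obtains b where "norm (b - a) < \<delta>" "b \<in> generates_near c \<epsilon>"
proof -
  have "min \<epsilon> (\<delta> / 2) > 0" using assms by simp
  then obtain F a' c' where F: "star_subalgebra F" "finite_dimensional F" "a' \<in> F" "c' \<in> F"
    and ac: "norm (a' - a) < min \<epsilon> (\<delta> / 2)" "norm (c' - c) < min \<epsilon> (\<delta> / 2)"
    using assms(1) unfolding locally_finite_dimensional_def by meson
  obtain b where b: "norm (b - a') < \<delta> / 2" "\<And>B. star_subalgebra B \<Longrightarrow> b \<in> B \<Longrightarrow> F \<subseteq> B"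
    using finite_dimensional_dense_generators[OF F(1-3), of "\<delta> / 2"] assms(3) by auto
  have "norm (b - a) < \<delta>" using b(1) ac(1) norm_triangle_ineq[of "b - a'" "a' - a"] by simp
  moreover have "c' \<in> cstar_generated {b}"
    using b(2)[of "cstar_generated {b}"] F(4) cstar_generated_subalgebra[of "{b}"]
      cstar_generated_superset[of "{b}"] by (auto simp: cstar_subalgebra_iff)
  then have "b \<in> generates_near c \<epsilon>" using ac(2) by (auto simp: generates_near_def norm_minus_commute)
  ultimately show thesis by (rule that)
qed

text \<open>Encode the pair as \<open>a 0 + \<i> *\<^sub>C a 1\<close>, perturb this element, and
  decode the result into its self-adjoint parts.\<close>

lemma generation_property_1:
  assumes "locally_finite_dimensional TYPE('a :: cstar_algebra)"
  shows "generation_property 1 TYPE('a)"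
  unfolding generation_property_def
proof (intro allI impI)
  fix a :: "nat \<Rightarrow> 'a" and \<epsilon> :: real and c :: 'a
  assume sa: "\<forall>j\<le>1. self_adjoint (a j)" and "\<epsilon> > 0"
  have "self_adjoint (a 0)" "self_adjoint (a 1)" using sa by simp_all
  then have sa01: "star (a 0) = a 0" "star (a 1) = a 1" unfolding self_adjoint_def .
  define x where "x = a 0 + \<i> *\<^sub>C a 1"
  obtain z where z: "norm (z - x) < \<epsilon>" "z \<in> generates_near c \<epsilon>"
    using dense_generates_near[OF assms \<open>\<epsilon> > 0\<close> \<open>\<epsilon> > 0\<close>] .
  obtain h k where hk: "z = h + \<i> *\<^sub>C k" "star h = h" "star k = k"
    using real_imaginary_parts .
  define y where "y = z - x"
  have y: "y = (h - a 0) + \<i> *\<^sub>C (k - a 1)" by (simp add: y_def x_def hk scaleC_diff_right)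
  have star_y: "star y = (h - a 0) - \<i> *\<^sub>C (k - a 1)"
    by (simp add: y star_add star_diff star_scaleC hk sa01 complex_vector.scale_minus_left del: One_nat_def)
  \<comment> \<open>The errors \<open>h - a 0\<close> and \<open>k - a 1\<close> are the
    self-adjoint parts of \<open>y\<close>, hence no larger than \<open>y\<close> in norm.\<close>
  have "2 *\<^sub>R (h - a 0) = y + star y" unfolding star_y unfolding y by (simp add: scaleR_2)
  then have "norm (2 *\<^sub>R (h - a 0)) \<le> 2 * norm y" using norm_triangle_ineq[of y "star y"] by simp
  then have h: "norm (h - a 0) < \<epsilon>" using z(1) by (simp add: y_def)
  have "2 *\<^sub>R (\<i> *\<^sub>C (k - a 1)) = y - star y" unfolding star_y unfolding y by (simp add: scaleR_2)
  then have "norm (2 *\<^sub>R (\<i> *\<^sub>C (k - a 1))) \<le> 2 * norm y"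
    using norm_triangle_ineq4[of y "star y"] by simp
  then have k: "norm (k - a 1) < \<epsilon>" using z(1) by (simp add: y_def norm_scaleC)
  define b where "b j = (if j = 0 then h else k)" for j :: nat
  have b_image: "b ` {..1} = {h, k}"
  proof -
    have "{..1} = {0, 1 :: nat}" by auto
    then show ?thesis by (auto simp: b_def)
  qed
  have "{h, k} \<subseteq> cstar_generated {h, k}" by (rule cstar_generated_superset)
  then have "z \<in> cstar_generated {h, k}"
    using cstar_generated_subalgebra[of "{h, k}"] by (auto simp: hk(1) cstar_subalgebra_iff star_subalgebraD)
  then have "cstar_generated {z} \<subseteq> cstar_generated (b ` {..1})"
    unfolding b_image by (intro cstar_generated_minimal cstar_generated_subalgebra) simp
  then have "\<exists>g\<in>cstar_generated (b ` {..1}). norm (c - g) < \<epsilon>"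
    using z(2) by (auto simp: generates_near_def)
  moreover have "\<forall>j\<le>1. self_adjoint (b j) \<and> norm (b j - a j) < \<epsilon>"
  proof (intro allI impI)
    fix j :: nat assume "j \<le> 1"
    then have "j = 0 \<or> j = 1" by auto
    then show "self_adjoint (b j) \<and> norm (b j - a j) < \<epsilon>"
      using h k hk by (auto simp: b_def self_adjoint_def)
  qed
  ultimately show "\<exists>b. (\<forall>j\<le>1. self_adjoint (b j) \<and> norm (b j - a j) < \<epsilon>) \<and>
      (\<exists>g\<in>cstar_generated (b ` {..1}). norm (c - g) < \<epsilon>)"
    by blast
qed

lemma gr0_le: "generation_property n TYPE('a :: cstar_algebra) \<Longrightarrow> gr0 TYPE('a) \<le> enat n"
  by (auto simp: gr0_def intro: Least_le)

text \<open>Allow arbitrary scalar parts next to \<open>F\<close>; this adds at most one dimension.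
  Approximants keep the scalar part, so the error lies in the original algebra, where the norms
  agree.\<close>

lemma locally_finite_dimensional_unitization:
  assumes A: "locally_finite_dimensional TYPE('a :: cstar_algebra)"
  shows "locally_finite_dimensional TYPE('a unitization)"
  unfolding locally_finite_dimensional_def
proof (intro allI impI)
  fix x y :: "'a unitization" and \<epsilon> :: real assume "\<epsilon> > 0"
  obtain F a' c' where F: "star_subalgebra F" "finite_dimensional F" "a' \<in> F" "c' \<in> F"
    and ac: "norm (a' - fst (components x)) < \<epsilon>" "norm (c' - fst (components y)) < \<epsilon>"
    using A \<open>\<epsilon> > 0\<close> unfolding locally_finite_dimensional_def by meson
  note F' = star_subalgebraD[OF F(1)]
  define G where "G = {z :: 'a unitization. fst (components z) \<in> F}"
  define \<iota> where "\<iota> a = Unitize (a, 0)" for a :: 'a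
  have \<iota>: "components (\<iota> a) = (a, 0)" for a unfolding \<iota>_def by (intro Unitize_inverse) auto
  have "star_subalgebra G"
    using F' by (intro star_subalgebraI) (auto simp: G_def zero_unitization.rep_eq
        plus_unitization.rep_eq scaleC_unitization.rep_eq times_unitization.rep_eq
        star_unitization.rep_eq case_prod_beta)
  moreover have "finite_dimensional G"
  proof -
    obtain S where S: "finite S" "F \<subseteq> complex_vector.span S"
      using F(2) by (auto simp: finite_dimensional_def)
    \<comment> \<open>\<open>u\<close> is the adjoined unit. For a unital algebra this value of
      \<open>Unitize\<close> is unspecified, but then every scalar part is 0 and \<open>u\<close>
      drops out of the decomposition.\<close>
    define u where "u = Unitize (0 :: 'a, 1)"
    have decomp: "z = \<iota> (fst (components z)) + snd (components z) *\<^sub>C u" for z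
    proof (cases "snd (components z) = 0")
      case True
      then show ?thesis
        by (simp flip: components_inject add: plus_unitization.rep_eq zero_unitization.rep_eq \<iota> case_prod_beta prod_eq_iff)
    next
      case False
      then have "\<not> (\<exists>e :: 'a. is_unit_element e)" using components[of z] by auto
      then have "components u = (0, 1)" unfolding u_def by (intro Unitize_inverse) auto
      then show ?thesis
        by (simp flip: components_inject add: plus_unitization.rep_eq scaleC_unitization.rep_eq \<iota> case_prod_beta prod_eq_iff)
    qed
    have \<iota>_add: "\<iota> (a + b) = \<iota> a + \<iota> b" and \<iota>_scale: "\<iota> (c *\<^sub>C a) = c *\<^sub>C \<iota> a" for a b c
      by (simp_all flip: components_inject add: plus_unitization.rep_eq scaleC_unitization.rep_eq \<iota>)
    have "complex_vector.subspace {a. \<iota> a \<in> complex_vector.span (\<iota> ` S)}"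
      unfolding complex_vector.subspace_def
      using \<iota>_scale[of 0 0] by (auto simp: \<iota>_add \<iota>_scale complex_vector.span_add
          complex_vector.span_scale complex_vector.span_zero)
    then have "complex_vector.span S \<subseteq> {a. \<iota> a \<in> complex_vector.span (\<iota> ` S)}"
      by (intro complex_vector.span_minimal) (auto intro: complex_vector.span_base)
    then have span_\<iota>: "\<iota> a \<in> complex_vector.span (insert u (\<iota> ` S))" if "a \<in> F" for a
      using that S(2) complex_vector.span_mono[of "\<iota> ` S" "insert u (\<iota> ` S)"] by blast
    have span_u: "u \<in> complex_vector.span (insert u (\<iota> ` S))"
      by (simp add: complex_vector.span_base)
    have "G \<subseteq> complex_vector.span (insert u (\<iota> ` S))"
    proof
      fix z assume "z \<in> G"
      then have "\<iota> (fst (components z)) + snd (components z) *\<^sub>C u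
          \<in> complex_vector.span (insert u (\<iota> ` S))"
        by (intro complex_vector.span_add complex_vector.span_scale span_\<iota> span_u)
          (simp add: G_def)
      then show "z \<in> complex_vector.span (insert u (\<iota> ` S))"
        by (simp only: decomp[of z, symmetric])
    qed
    moreover have "finite (insert u (\<iota> ` S))" using S(1) by simp
    ultimately show ?thesis unfolding finite_dimensional_def by (intro exI conjI)
  qed
  moreover have near: "\<exists>z'\<in>G. norm (z' - z) < \<epsilon>"
    if "a \<in> F" "norm (a - fst (components z)) < \<epsilon>" for a z
  proof -
    define d where "d = a - fst (components z)"
    have c: "components (z + \<iota> d) = (a, snd (components z))"
      by (simp add: plus_unitization.rep_eq \<iota> d_def case_prod_beta)
    have "norm (\<iota> d) = norm d" unfolding \<iota>_def by (rule norm_unitization_embedding)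
    then show ?thesis using that c by (intro bexI[of _ "z + \<iota> d"]) (auto simp: G_def d_def)
  qed
  ultimately show "\<exists>F. star_subalgebra F \<and> finite_dimensional F \<and>
      (\<exists>a'\<in>F. norm (a' - x) < \<epsilon>) \<and> (\<exists>c'\<in>F. norm (c' - y) < \<epsilon>)"
    using near[OF F(3) ac(1)] near[OF F(4) ac(2)] by blast
qed

section \<open>From inductive limits to local approximation\<close>

lemma star_subalgebra_image:
  assumes "star_hom_on B f" "star_subalgebra B"
  shows "star_subalgebra (f ` B)"
proof (rule star_subalgebraI)
  note B' = star_subalgebraD[OF assms(2)]
  have f: "\<And>x y. x \<in> B \<Longrightarrow> y \<in> B \<Longrightarrow> f (x + y) = f x + f y"
    "\<And>c x. x \<in> B \<Longrightarrow> f (c *\<^sub>C x) = c *\<^sub>C f x"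
    "\<And>x y. x \<in> B \<Longrightarrow> y \<in> B \<Longrightarrow> f (x * y) = f x * f y"
    "\<And>x. x \<in> B \<Longrightarrow> f (star x) = star (f x)"
    using assms(1) by (auto simp: star_hom_on_def)
  show "0 \<in> f ` B" using f(2)[of 0 0] B'(2) by (auto simp: image_iff)
  show "x + y \<in> f ` B" if "x \<in> f ` B" "y \<in> f ` B" for x y
    using that B' f(1) by (metis (no_types, lifting) image_iff)
  show "x * y \<in> f ` B" if "x \<in> f ` B" "y \<in> f ` B" for x y
    using that B' f(3) by (metis (no_types, lifting) image_iff)
  show "c *\<^sub>C x \<in> f ` B" if "x \<in> f ` B" for c x
    using that B' f(2) by (metis (no_types, lifting) image_iff)
  show "star x \<in> f ` B" if "x \<in> f ` B" for x
    using that B' f(4) by (metis (no_types, lifting) image_iff)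
qed

lemma finite_dimensional_image:
  assumes f: "star_hom_on B f" and B: "complex_vector.subspace B" "finite_dimensional B"
  shows "finite_dimensional (f ` B)"
proof -
  obtain S where S: "finite S" "B \<subseteq> complex_vector.span S"
    using B(2) by (auto simp: finite_dimensional_def)
  \<comment> \<open>\<open>f\<close> is linear only on \<open>B\<close>, and the spanning set
    \<open>S\<close> may leave \<open>B\<close>; a basis inside \<open>B\<close> is needed.\<close>
  obtain A where A: "A \<subseteq> B" "\<not> complex_vector.dependent A" "B \<subseteq> complex_vector.span A"
    using complex_vector.basis_exists[of B] by metis
  have "finite A" using complex_vector.independent_span_bound[OF S(1) A(2)] A(1) S(2) by blast
  have f0: "f 0 = 0" using f complex_vector.subspace_0[OF B(1)]
    by (metis scaleC_zero_left star_hom_on_def)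
  have "complex_vector.subspace {x\<in>B. f x \<in> complex_vector.span (f ` A)}"
    using B(1) f f0 by (auto simp: complex_vector.subspace_def star_hom_on_def
        complex_vector.span_add complex_vector.span_scale complex_vector.span_zero)
  then have "complex_vector.span A \<subseteq> {x\<in>B. f x \<in> complex_vector.span (f ` A)}"
    using A(1) by (intro complex_vector.span_minimal) (auto intro: complex_vector.span_base)
  then have "f ` B \<subseteq> complex_vector.span (f ` A)" using A(3) by blast
  moreover have "finite (f ` A)" using \<open>finite A\<close> by simp
  ultimately show ?thesis unfolding finite_dimensional_def by (intro exI conjI)
qed

text \<open>Two elements are approximated in the images of two stages; by directedness both images
  lie in that of a common later stage, which is a finite-dimensional *-subalgebra.\<close>

lemma AF_algebra_locally_finite_dimensional:
  assumes "AF_algebra TYPE('i) TYPE('b :: cstar_algebra) TYPE('a :: cstar_algebra)"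
  shows "locally_finite_dimensional TYPE('a)"
  unfolding locally_finite_dimensional_def
proof (intro allI impI)
  fix a c :: 'a and \<epsilon> :: real assume \<epsilon>: "\<epsilon> > 0"
  obtain I :: "'i set" and le B \<phi> and \<psi> :: "'i \<Rightarrow> 'b \<Rightarrow> 'a"
    where sys: "cstar_inductive_system I le B \<phi>" and fd: "\<forall>i\<in>I. finite_dimensional (B i)"
      and lim: "is_inductive_limit I le B \<phi> \<psi>"
    using assms unfolding AF_algebra_def by blast
  have directed: "\<forall>i\<in>I. \<forall>j\<in>I. \<exists>k\<in>I. le i k \<and> le j k"
    using sys unfolding cstar_inductive_system_def by (elim conjE)
  have alg: "\<forall>i\<in>I. cstar_subalgebra (B i)"
    using sys unfolding cstar_inductive_system_def by (elim conjE)
  have maps: "\<forall>i\<in>I. \<forall>j\<in>I. le i j \<longrightarrow> \<phi> i j ` B i \<subseteq> B j \<and> star_hom_on (B i) (\<phi> i j)"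
    using sys unfolding cstar_inductive_system_def by (elim conjE)
  have hom: "\<forall>i\<in>I. star_hom_on (B i) (\<psi> i)"
    using lim unfolding is_inductive_limit_def by (elim conjE)
  have compat: "\<forall>i\<in>I. \<forall>j\<in>I. le i j \<longrightarrow> (\<forall>x\<in>B i. \<psi> j (\<phi> i j x) = \<psi> i x)"
    using lim unfolding is_inductive_limit_def by (elim conjE)
  have dense: "closure (\<Union>i\<in>I. \<psi> i ` B i) = UNIV"
    using lim unfolding is_inductive_limit_def by (elim conjE)
  have approx: "\<exists>i\<in>I. \<exists>x\<in>\<psi> i ` B i. norm (x - z) < \<epsilon>" for z
  proof -
    have "z \<in> closure (\<Union>i\<in>I. \<psi> i ` B i)" by (simp add: dense)
    then show ?thesis using \<epsilon> by (auto simp: closure_approachable dist_norm)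
  qed
  have sub: "\<psi> i ` B i \<subseteq> \<psi> j ` B j" if "i \<in> I" "j \<in> I" "le i j" for i j
  proof -
    have "\<phi> i j ` B i \<subseteq> B j" using maps that by blast
    moreover have "\<forall>x\<in>B i. \<psi> j (\<phi> i j x) = \<psi> i x" using compat that by blast
    ultimately show ?thesis by (metis (no_types, lifting) image_subset_iff imageI)
  qed
  obtain i x where i: "i \<in> I" "x \<in> \<psi> i ` B i" "norm (x - a) < \<epsilon>"
    using approx[of a] by blast
  obtain j y where j: "j \<in> I" "y \<in> \<psi> j ` B j" "norm (y - c) < \<epsilon>"
    using approx[of c] by blast
  obtain k where k: "k \<in> I" "le i k" "le j k" using directed i(1) j(1) by blast
  have "x \<in> \<psi> k ` B k" using sub[OF i(1) k(1,2)] i(2) by (rule subsetD)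
  moreover have "y \<in> \<psi> k ` B k" using sub[OF j(1) k(1,3)] j(2) by (rule subsetD)
  moreover have hom_k: "star_hom_on (B k) (\<psi> k)" using hom k(1) by blast
  moreover have alg_k: "star_subalgebra (B k)"
    using alg k(1) by (simp add: cstar_subalgebra_iff)
  moreover have "star_subalgebra (\<psi> k ` B k)" using hom_k alg_k by (rule star_subalgebra_image)
  moreover have "finite_dimensional (\<psi> k ` B k)"
    using hom_k star_subalgebraD(1)[OF alg_k] fd k(1) by (simp add: finite_dimensional_image)
  ultimately show "\<exists>F. star_subalgebra F \<and> finite_dimensional F \<and>
      (\<exists>a'\<in>F. norm (a' - a) < \<epsilon>) \<and> (\<exists>c'\<in>F. norm (c' - c) < \<epsilon>)"
    using i(3) j(3) by blast
qed

section \<open>Generic generators by Baire category\<close>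

lemma generators_gdelta_dense:
  assumes sep: "separable_space (euclidean :: 'a :: cstar_algebra topology)"
    and A: "locally_finite_dimensional TYPE('a)"
  shows "gdelta {a :: 'a. cstar_generated {a} = UNIV}"
    and "closure {a :: 'a. cstar_generated {a} = UNIV} = UNIV"
proof -
  obtain C :: "'a set" where C: "countable C" "closure C = UNIV"
    using sep by (auto simp: separable_space_def)
  then have "C \<noteq> {}" by auto
  \<comment> \<open>One index runs over all pairs of a point of \<open>C\<close> and a tolerance
    \<open>1 / (k + 1)\<close>. A closed subalgebra that comes arbitrarily close to every point of
    the dense set \<open>C\<close> is everything.\<close>
  define G where "G n = generates_near (from_nat_into C (fst (prod_decode n)))
    (inverse (Suc (snd (prod_decode n))))" for n
  have eq: "{a. cstar_generated {a} = UNIV} = \<Inter>(range G)"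
  proof (intro set_eqI iffI)
    fix a :: 'a assume "a \<in> {a. cstar_generated {a} = UNIV}"
    then have "a \<in> G n" for n
      by (auto simp: G_def generates_near_def
          intro: exI[of _ "from_nat_into C (fst (prod_decode n))"])
    then show "a \<in> \<Inter>(range G)" by blast
  next
    fix a assume a: "a \<in> \<Inter>(range G)"
    have closed: "closed (cstar_generated {a})"
      using cstar_generated_subalgebra by (auto simp: cstar_subalgebra_iff)
    have "c \<in> closure (cstar_generated {a})" if cC: "c \<in> C" for c
      unfolding closure_approachable
    proof (intro allI impI)
      fix \<epsilon> :: real assume "\<epsilon> > 0"
      then obtain n where n: "inverse (Suc n) < \<epsilon>" using reals_Archimedean by blast
      obtain m where m: "from_nat_into C m = c"
        using from_nat_into_surj[OF C(1) cC] by blast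
      have "a \<in> G (prod_encode (m, n))" using a by blast
      then obtain g where "g \<in> cstar_generated {a}" "norm (c - g) < inverse (Suc n)"
        by (auto simp: G_def m generates_near_def)
      then show "\<exists>y\<in>cstar_generated {a}. dist y c < \<epsilon>"
        using n by (intro bexI[of _ g]) (auto simp: dist_norm norm_minus_commute)
    qed
    then have "C \<subseteq> cstar_generated {a}" using closed by auto
    then have "closure C \<subseteq> cstar_generated {a}" using closed by (rule closure_minimal)
    then show "a \<in> {a. cstar_generated {a} = UNIV}" using C(2) by auto
  qed
  have open_G: "open (G n)" for n by (simp add: G_def open_generates_near)
  then show "gdelta {a :: 'a. cstar_generated {a} = UNIV}" unfolding eq by (rule gdelta.intros)
  have "closure (G n) = UNIV" for n
  proof -
    have "\<exists>y\<in>G n. dist y a < \<delta>" if "\<delta> > 0" for a \<delta>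
      unfolding G_def using dense_generates_near[OF A _ that]
      by (metis dist_norm inverse_positive_iff_positive of_nat_0_less_iff zero_less_Suc)
    then show ?thesis by (auto simp: closure_approachable)
  qed
  \<comment> \<open>Baire's theorem applies because a C*-algebra is complete.\<close>
  then have "euclidean closure_of \<Inter>(range G) = topspace euclidean"
    using open_G by (intro Baire_category) (auto simp: completely_metrizable_space_euclidean)
  then show "closure {a :: 'a. cstar_generated {a} = UNIV} = UNIV" unfolding eq by simp
qed

theorem theorem4:
  assumes "separable_space (euclidean :: 'a :: cstar_algebra topology)"
    and "AF_algebra TYPE('i) TYPE('b :: cstar_algebra) TYPE('a)"
  shows "generator_rank TYPE('a) \<le> 1 \<and>
         gdelta {a :: 'a. cstar_generated {a} = UNIV} \<and>
         closure {a :: 'a. cstar_generated {a} = UNIV} = UNIV \<and>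
         (\<exists>a :: 'a. cstar_generated {a} = UNIV)"
proof -
  have A: "locally_finite_dimensional TYPE('a)"
    using assms(2) by (rule AF_algebra_locally_finite_dimensional)
  have "generator_rank TYPE('a) \<le> 1"
    using gr0_le[OF generation_property_1[OF locally_finite_dimensional_unitization[OF A]]]
    by (simp add: generator_rank_def one_enat_def)
  moreover have "\<exists>a :: 'a. cstar_generated {a} = UNIV"
  \<comment> \<open>The empty set is not dense, since the algebra contains 0.\<close>
  proof (rule ccontr)
    assume "\<not> ?thesis"
    then have "{a :: 'a. cstar_generated {a} = UNIV} = {}" by simp
    then show False using generators_gdelta_dense(2)[OF assms(1) A] by simp
  qed
  ultimately show ?thesis using generators_gdelta_dense[OF assms(1) A] by blast
qed

end
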